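(* Given a graph $G$ with $n$ vertices and $m$ edges and an edge $xy$ of $G$, one can decide whether $xy$ is an avoidable edge of $G$ in $O(n\cdot m)$ time.
   Context: All graphs are finite, simple and undirected. A $P_4$ is an induced path on four vertices; the middle edge of a $P_4=a,b,c,d$ is $bc$. An edge $uv$ is simplicial if there is no $P_4$ having $uv$ as middle edge, and avoidable if either it is simplicial or every $P_4$ with middle edge $uv$ is contained in an induced cycle. *)

theory Defs
  imports Main
begin

section \<open>Finite simple undirected graphs\<close>

definition ugraph :: "'a set \<Rightarrow> 'a set set \<Rightarrow> bool" where
  "ugraph V E \<longleftrightarrow> finite V \<and> (\<forall>e\<in>E. e \<subseteq> V \<and> card e = 2)"

definition induced_path :: "'a set \<Rightarrow> 'a set set \<Rightarrow> 'a list \<Rightarrow> bool" where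
  "induced_path V E p \<longleftrightarrow> p \<noteq> [] \<and> distinct p \<and> set p \<subseteq> V \<and>
     (\<forall>i<length p. \<forall>j<length p. {p ! i, p ! j} \<in> E \<longleftrightarrow> j = Suc i \<or> i = Suc j)"

definition induced_cycle :: "'a set \<Rightarrow> 'a set set \<Rightarrow> 'a list \<Rightarrow> bool" where
  "induced_cycle V E c \<longleftrightarrow> 3 \<le> length c \<and> distinct c \<and> set c \<subseteq> V \<and>
     (\<forall>i<length c. \<forall>j<length c. {c ! i, c ! j} \<in> E \<longleftrightarrow>
        j = Suc i mod length c \<or> i = Suc j mod length c)"

definition P4 :: "'a set \<Rightarrow> 'a set set \<Rightarrow> 'a list \<Rightarrow> bool" where
  "P4 V E p \<longleftrightarrow> induced_path V E p \<and> length p = 4"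

definition middle_edge :: "'a list \<Rightarrow> 'a set" where
  "middle_edge p = {p ! 1, p ! 2}"

definition simplicial_edge :: "'a set \<Rightarrow> 'a set set \<Rightarrow> 'a set \<Rightarrow> bool" where
  "simplicial_edge V E e \<longleftrightarrow> e \<in> E \<and> \<not> (\<exists>p. P4 V E p \<and> middle_edge p = e)"

text \<open>Paths and cycles below are induced, so a path is contained in a cycle as a subgraph
  iff its vertex set is.\<close>

definition avoidable_edge :: "'a set \<Rightarrow> 'a set set \<Rightarrow> 'a set \<Rightarrow> bool" where
  "avoidable_edge V E e \<longleftrightarrow> e \<in> E \<and>
     (simplicial_edge V E e \<or>
      (\<forall>p. P4 V E p \<and> middle_edge p = e \<longrightarrow>
         (\<exists>c. induced_cycle V E c \<and> set p \<subseteq> set c)))"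


section \<open>Random access machines\<close>

text \<open>The unit-cost random access machine over the natural numbers, with addition and truncated
  subtraction as the only arithmetic. A program mentions finitely many registers;
  the unbounded memory is accessed through addresses held in registers. The machine halts
  when the program counter leaves the program.\<close>

type_synonym reg = nat

datatype instr =
    Const reg nat
  | Copy reg reg
  | Add reg reg reg
  | Sub reg reg reg
  | Load reg reg      \<comment> \<open>\<open>Load r s\<close>: \<open>r := mem[s]\<close>\<close>
  | Store reg reg     \<comment> \<open>\<open>Store r s\<close>: \<open>mem[r] := s\<close>\<close>
  | Jump nat
  | JumpZero reg nat

type_synonym program = "instr list"

datatype config = Config (pc: nat) (regs: "reg \<Rightarrow> nat") (mem: "nat \<Rightarrow> nat")

fun exec :: "instr \<Rightarrow> config \<Rightarrow> config" where
  "exec (Const r k) (Config p R M) = Config (Suc p) (R(r := k)) M"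
| "exec (Copy r s) (Config p R M) = Config (Suc p) (R(r := R s)) M"
| "exec (Add r s t) (Config p R M) = Config (Suc p) (R(r := R s + R t)) M"
| "exec (Sub r s t) (Config p R M) = Config (Suc p) (R(r := R s - R t)) M"
| "exec (Load r s) (Config p R M) = Config (Suc p) (R(r := M (R s))) M"
| "exec (Store r s) (Config p R M) = Config (Suc p) R (M(R r := R s))"
| "exec (Jump l) (Config p R M) = Config l R M"
| "exec (JumpZero r l) (Config p R M) = Config (if R r = 0 then l else Suc p) R M"

definition halted :: "program \<Rightarrow> config \<Rightarrow> bool" where
  "halted P s \<longleftrightarrow> length P \<le> pc s"

definition step :: "program \<Rightarrow> config \<Rightarrow> config" where
  "step P s = (if halted P s then s else exec (P ! pc s) s)"

definition initial :: "nat list \<Rightarrow> config" where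
  "initial w = Config 0 (\<lambda>_. 0) (\<lambda>i. if i < length w then w ! i else 0)"

text \<open>On input \<open>w\<close> the program halts after at most \<open>T\<close> steps, and register \<open>0\<close> then holds
  the truth value of \<open>b\<close>.\<close>

definition answers_within :: "program \<Rightarrow> nat list \<Rightarrow> bool \<Rightarrow> nat \<Rightarrow> bool" where
  "answers_within P w b T \<longleftrightarrow>
     (\<exists>t\<le>T. let s = (step P ^^ t) (initial w) in
        halted P s \<and> regs s 0 = (if b then 1 else 0))"


section \<open>Encoding of graphs\<close>

text \<open>The vertices are \<open>0, \<dots>, n - 1\<close>. Every edge is listed exactly once, in arbitrary order and
  with arbitrary orientation.\<close>

definition lists_edges :: "(nat \<times> nat) list \<Rightarrow> nat set set \<Rightarrow> bool" where
  "lists_edges es E \<longleftrightarrow>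
     distinct (map (\<lambda>(u, v). {u, v}) es) \<and> set (map (\<lambda>(u, v). {u, v}) es) = E"

definition encode :: "nat \<Rightarrow> (nat \<times> nat) list \<Rightarrow> nat \<Rightarrow> nat \<Rightarrow> nat list" where
  "encode n es x y = [n, length es, x, y] @ concat (map (\<lambda>(u, v). [u, v]) es)"

end

theory Submission
  imports Defs
begin

text \<open>
  Let \<open>W\<close> be the set of vertices outside the closed neighbourhoods of \<open>x\<close> and \<open>y\<close>. A \<open>P\<^sub>4\<close>
  \<open>a, x, y, b\<close> lies in an induced cycle iff \<open>a\<close> and \<open>b\<close> have neighbours in a common component of
  the subgraph induced by \<open>W\<close>: the rest of such a cycle runs through \<open>W\<close>, and conversely a shortest
  path from \<open>a\<close> to \<open>b\<close> with interior in \<open>W\<close> closes up with \<open>x, y\<close> to an induced cycle.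

  The components of \<open>W\<close> are found by relabelling all vertices once per edge, in \<open>O(n)\<close> steps each. Then
  every \<open>a\<close> adjacent to \<open>x\<close> but not to \<open>y\<close> takes three passes over the edge list: mark the labels of
  the neighbours of \<open>a\<close>, mark every vertex adjacent to a marked component, and test that
  every \<open>b\<close> adjacent to \<open>y\<close> but not to \<open>x\<close> is marked. Vertices outside \<open>W\<close> keep their own label, so
  the first pass also accounts for the \<open>b\<close> adjacent to \<open>a\<close>.
\<close>

section \<open>Structured programs for the random access machine\<close>

datatype com =
    Ins instr
  | Seq com com  (infixr ";;" 60)
  | IfZ reg com
  | IfNZ reg com
  | While reg com

primrec csize :: "com \<Rightarrow> nat" where
  "csize (Ins i) = 1"
| "csize (c ;; d) = csize c + csize d"
| "csize (IfZ r c) = csize c + 2"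
| "csize (IfNZ r c) = csize c + 1"
| "csize (While r c) = csize c + 2"

text \<open>Jump targets are absolute, so the start address is a parameter. The only conditional
  jump tests for zero, hence \<open>IfZ\<close> needs a second jump to skip its body.\<close>

primrec compile :: "nat \<Rightarrow> com \<Rightarrow> program" where
  "compile p (Ins i) = [i]"
| "compile p (c ;; d) = compile p c @ compile (p + csize c) d"
| "compile p (IfZ r c) = JumpZero r (p + 2) # Jump (p + 2 + csize c) # compile (p + 2) c"
| "compile p (IfNZ r c) = JumpZero r (p + 1 + csize c) # compile (p + 1) c"
| "compile p (While r c) = JumpZero r (p + 2 + csize c) # compile (p + 1) c @ [Jump p]"

lemma length_compile [simp]: "length (compile p c) = csize c"
  by (induction c arbitrary: p) auto

section \<open>Placement of code and timed total correctness\<close>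

definition code_at :: "program \<Rightarrow> nat \<Rightarrow> program \<Rightarrow> bool" where
  "code_at P p xs \<longleftrightarrow> (\<forall>i<length xs. p + i < length P \<and> P ! (p + i) = xs ! i)"

lemma code_at_append [simp]:
  "code_at P p (xs @ ys) \<longleftrightarrow> code_at P p xs \<and> code_at P (p + length xs) ys"
proof
  assume a: "code_at P p (xs @ ys)"
  have "p + length xs + i < length P \<and> P ! (p + length xs + i) = ys ! i" if "i < length ys" for i
    using a[unfolded code_at_def, rule_format, of "length xs + i"] that by (simp add: add.assoc)
  moreover have "p + i < length P \<and> P ! (p + i) = xs ! i" if "i < length xs" for i
    using a[unfolded code_at_def, rule_format, of i] that by (simp add: nth_append)
  ultimately show "code_at P p xs \<and> code_at P (p + length xs) ys"
    by (simp add: code_at_def)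
next
  assume a: "code_at P p xs \<and> code_at P (p + length xs) ys"
  have "p + i < length P \<and> P ! (p + i) = (xs @ ys) ! i" if "i < length (xs @ ys)" for i
  proof (cases "i < length xs")
    case True
    then show ?thesis using a by (simp add: code_at_def nth_append)
  next
    case False
    then have "i - length xs < length ys" "p + i = p + length xs + (i - length xs)"
      using that by auto
    then show ?thesis using a False unfolding code_at_def by (metis nth_append)
  qed
  then show "code_at P p (xs @ ys)" by (simp add: code_at_def)
qed

lemma code_at_Nil [simp]: "code_at P p []"
  by (simp add: code_at_def)

lemma code_at_Cons [simp]:
  "code_at P p (i # xs) \<longleftrightarrow> p < length P \<and> P ! p = i \<and> code_at P (Suc p) xs"
proof -
  have "code_at P p [i] \<longleftrightarrow> p < length P \<and> P ! p = i"
    by (simp add: code_at_def)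
  then show ?thesis
    using code_at_append[of P p "[i]" xs] by simp
qed

text \<open>Total correctness with a time bound: wherever \<open>c\<close> is placed in a program, from registers \<open>R\<close>
  and memory \<open>M\<close> control reaches the end of \<open>c\<close> within \<open>T\<close> steps, in a state satisfying \<open>Q\<close>.\<close>

definition ht :: "com \<Rightarrow> nat \<Rightarrow> (reg \<Rightarrow> nat) \<Rightarrow> (nat \<Rightarrow> nat) \<Rightarrow>
    ((reg \<Rightarrow> nat) \<Rightarrow> (nat \<Rightarrow> nat) \<Rightarrow> bool) \<Rightarrow> bool" where
  "ht c T R M Q \<longleftrightarrow> (\<forall>P p. code_at P p (compile p c) \<longrightarrow>
     (\<exists>t\<le>T. \<exists>R' M'. (step P ^^ t) (Config p R M) = Config (p + csize c) R' M' \<and> Q R' M'))"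

lemma htE:
  assumes "ht c T R M Q" "code_at P p (compile p c)"
  obtains t R' M' where "t \<le> T" "(step P ^^ t) (Config p R M) = Config (p + csize c) R' M'" "Q R' M'"
  using assms unfolding ht_def by blast

lemma step_code: "p < length P \<Longrightarrow> step P (Config p R M) = exec (P ! p) (Config p R M)"
  by (simp add: step_def halted_def)

lemma funpow_trans: "(f ^^ t) s = s' \<Longrightarrow> (f ^^ u) s' = s'' \<Longrightarrow> (f ^^ (u + t)) s = s''"
  by (simp add: funpow_add)

lemma ht_mono:
  assumes "ht c T R M Q" "T \<le> T'" "\<And>R' M'. Q R' M' \<Longrightarrow> Q' R' M'"
  shows "ht c T' R M Q'"
  using assms unfolding ht_def by (meson le_trans)

lemma ht_Seq:
  assumes "ht c T R M Q" "\<And>R' M'. Q R' M' \<Longrightarrow> ht d U R' M' Q'"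
  shows "ht (c ;; d) (T + U) R M Q'"
  unfolding ht_def
proof (intro allI impI)
  fix P p assume c: "code_at P p (compile p (c ;; d))"
  then have c1: "code_at P p (compile p c)" and c2: "code_at P (p + csize c) (compile (p + csize c) d)"
    by simp_all
  from htE[OF assms(1) c1] obtain t R1 M1 where
    1: "t \<le> T" "(step P ^^ t) (Config p R M) = Config (p + csize c) R1 M1" "Q R1 M1" .
  from htE[OF assms(2)[OF 1(3)] c2] obtain u R2 M2 where
    2: "u \<le> U" "(step P ^^ u) (Config (p + csize c) R1 M1) = Config (p + csize c + csize d) R2 M2" "Q' R2 M2" .
  show "\<exists>t\<le>T + U. \<exists>R' M'. (step P ^^ t) (Config p R M) = Config (p + csize (c ;; d)) R' M' \<and> Q' R' M'"
    using funpow_trans[OF 1(2) 2(2)] 1(1) 2(1,3)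
    by (intro exI[of _ "u + t"] conjI exI[of _ R2] exI[of _ M2]) (auto simp: add.assoc)
qed

lemma ht_IfZ:
  assumes "R r = 0 \<Longrightarrow> ht c T R M Q" "R r \<noteq> 0 \<Longrightarrow> Q R M"
  shows "ht (IfZ r c) (T + 2) R M Q"
  unfolding ht_def
proof (intro allI impI)
  fix P p assume c: "code_at P p (compile p (IfZ r c))"
  show "\<exists>t\<le>T + 2. \<exists>R' M'. (step P ^^ t) (Config p R M) = Config (p + csize (IfZ r c)) R' M' \<and> Q R' M'"
  proof (cases "R r = 0")
    case True
    have c1: "code_at P (p + 2) (compile (p + 2) c)" using c by simp
    from htE[OF assms(1) c1] True obtain t R1 M1 where
      1: "t \<le> T" "(step P ^^ t) (Config (p + 2) R M) = Config (p + 2 + csize c) R1 M1" "Q R1 M1" by blast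
    have "(step P ^^ 1) (Config p R M) = Config (p + 2) R M"
      using c True by (simp add: step_code)
    from funpow_trans[OF this 1(2)] 1 show ?thesis
      by (intro exI[of _ "t + 1"] conjI exI[of _ R1] exI[of _ M1]) (auto simp: algebra_simps)
  next
    case False
    have "(step P ^^ 2) (Config p R M) = Config (p + 2 + csize c) R M"
      using c False by (simp add: step_code numeral_2_eq_2)
    with assms(2)[OF False] show ?thesis
      by (intro exI[of _ 2] conjI exI[of _ R] exI[of _ M]) (auto simp: algebra_simps)
  qed
qed

lemma ht_IfNZ:
  assumes "R r \<noteq> 0 \<Longrightarrow> ht c T R M Q" "R r = 0 \<Longrightarrow> Q R M"
  shows "ht (IfNZ r c) (T + 1) R M Q"
  unfolding ht_def
proof (intro allI impI)
  fix P p assume c: "code_at P p (compile p (IfNZ r c))"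
  show "\<exists>t\<le>T + 1. \<exists>R' M'. (step P ^^ t) (Config p R M) = Config (p + csize (IfNZ r c)) R' M' \<and> Q R' M'"
  proof (cases "R r = 0")
    case False
    have c1: "code_at P (p + 1) (compile (p + 1) c)" using c by simp
    from htE[OF assms(1) c1] False obtain t R1 M1 where
      1: "t \<le> T" "(step P ^^ t) (Config (p + 1) R M) = Config (p + 1 + csize c) R1 M1" "Q R1 M1" by blast
    have "(step P ^^ 1) (Config p R M) = Config (p + 1) R M"
      using c False by (simp add: step_code)
    from funpow_trans[OF this 1(2)] 1 show ?thesis
      by (intro exI[of _ "t + 1"] conjI exI[of _ R1] exI[of _ M1]) (auto simp: algebra_simps)
  next
    case True
    have "(step P ^^ 1) (Config p R M) = Config (p + 1 + csize c) R M"
      using c True by (simp add: step_code)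
    with assms(2)[OF True] show ?thesis
      by (intro exI[of _ 1] conjI exI[of _ R] exI[of _ M]) (auto simp: algebra_simps)
  qed
qed

text \<open>The invariant is indexed by the number of completed rounds, so the iteration count is
  known in advance. A round adds two steps, the test and the jump back; the final test adds
  one.\<close>

lemma ht_While:
  assumes body: "\<And>k R M. k < N \<Longrightarrow> J k R M \<Longrightarrow> R r \<noteq> 0 \<and> ht c T R M (J (Suc k))"
    and exit: "\<And>R M. J N R M \<Longrightarrow> R r = 0"
    and init: "J 0 R M"
  shows "ht (While r c) (N * (T + 2) + 1) R M (J N)"
  unfolding ht_def
proof (intro allI impI)
  fix P p assume c: "code_at P p (compile p (While r c))"
  have iter: "\<exists>t\<le>k * (T + 2). \<exists>R' M'. (step P ^^ t) (Config p R M) = Config p R' M' \<and> J k R' M'"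
    if "k \<le> N" for k
    using that
  proof (induction k)
    case 0
    then show ?case using init by auto
  next
    case (Suc k)
    then obtain t R1 M1 where 1: "t \<le> k * (T + 2)" "(step P ^^ t) (Config p R M) = Config p R1 M1" "J k R1 M1"
      by auto
    have k: "k < N" using Suc by simp
    note b = body[OF k 1(3)]
    have "(step P ^^ 1) (Config p R1 M1) = Config (p + 1) R1 M1"
      using c b by (simp add: step_code)
    note s1 = funpow_trans[OF 1(2) this]
    have c1: "code_at P (p + 1) (compile (p + 1) c)" using c by simp
    from htE[OF conjunct2[OF b] c1] obtain u R2 M2 where
      2: "u \<le> T" "(step P ^^ u) (Config (p + 1) R1 M1) = Config (p + 1 + csize c) R2 M2" "J (Suc k) R2 M2" .
    note s2 = funpow_trans[OF s1 2(2)]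
    have "(step P ^^ 1) (Config (p + 1 + csize c) R2 M2) = Config p R2 M2"
      using c by (simp add: step_code)
    from funpow_trans[OF s2 this] 1(1) 2(1,3) show ?case
      by (intro exI[of _ "1 + (u + (1 + t))"] conjI exI[of _ R2] exI[of _ M2]) auto
  qed
  from iter[of N] obtain t R1 M1 where 1: "t \<le> N * (T + 2)" "(step P ^^ t) (Config p R M) = Config p R1 M1" "J N R1 M1"
    by auto
  have "(step P ^^ 1) (Config p R1 M1) = Config (p + 2 + csize c) R1 M1"
    using c exit[OF 1(3)] by (simp add: step_code)
  from funpow_trans[OF 1(2) this] 1
  show "\<exists>t\<le>N * (T + 2) + 1. \<exists>R' M'. (step P ^^ t) (Config p R M) = Config (p + csize (While r c)) R' M' \<and> J N R' M'"
    by (intro exI[of _ "1 + t"] conjI exI[of _ R1] exI[of _ M1]) (auto simp: algebra_simps)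
qed

section \<open>Evaluation of loop-free code\<close>

text \<open>Bare jumps are rejected as well, because \<open>run\<close> discards the program
  counter.\<close>

fun loop_free :: "com \<Rightarrow> bool" where
  "loop_free (Ins (Jump l)) = False"
| "loop_free (Ins (JumpZero r l)) = False"
| "loop_free (Ins i) = True"
| "loop_free (c ;; d) \<longleftrightarrow> loop_free c \<and> loop_free d"
| "loop_free (IfZ r c) = loop_free c"
| "loop_free (IfNZ r c) = loop_free c"
| "loop_free (While r c) = False"

text \<open>The values of \<open>cost\<close> and \<open>run\<close> on loops are junk.\<close>

primrec cost :: "com \<Rightarrow> nat" where
  "cost (Ins i) = 1"
| "cost (c ;; d) = cost c + cost d"
| "cost (IfZ r c) = cost c + 2"
| "cost (IfNZ r c) = cost c + 1"
| "cost (While r c) = 0"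

primrec run :: "com \<Rightarrow> (reg \<Rightarrow> nat) \<times> (nat \<Rightarrow> nat) \<Rightarrow> (reg \<Rightarrow> nat) \<times> (nat \<Rightarrow> nat)" where
  "run (Ins i) s = (let s' = exec i (Config 0 (fst s) (snd s)) in (regs s', mem s'))"
| "run (c ;; d) s = run d (run c s)"
| "run (IfZ r c) s = (if fst s r = 0 then run c s else s)"
| "run (IfNZ r c) s = (if fst s r = 0 then s else run c s)"
| "run (While r c) s = s"

lemma ht_loop_free:
  "loop_free c \<Longrightarrow> run c (R, M) = (R', M') \<Longrightarrow> ht c (cost c) R M (\<lambda>R1 M1. R1 = R' \<and> M1 = M')"
proof (induction c arbitrary: R M R' M')
  case (Ins i)
  have "step P (Config p R M) = Config (Suc p) R' M'" if "code_at P p (compile p (Ins i))" for P p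
    using that Ins by (cases i) (auto simp: step_code Let_def)
  then show ?case
    by (auto simp: ht_def intro!: exI[of _ "1::nat"])
next
  case (Seq c d)
  obtain R1 M1 where 1: "run c (R, M) = (R1, M1)" by fastforce
  then show ?case
    using Seq.IH(1)[of R M R1 M1] Seq.IH(2)[of R1 M1 R' M'] Seq.prems
    by (auto intro!: ht_Seq)
next
  case (IfZ r c)
  then show ?case by (auto intro!: ht_IfZ split: if_splits simp del: One_nat_def add_2_eq_Suc' add_2_eq_Suc)
next
  case (IfNZ r c)
  then show ?case by (auto intro!: ht_IfNZ split: if_splits simp del: One_nat_def add_Suc_right)
next
  case (While r c)
  then show ?case by simp
qed

text \<open>Reduces a triple for loop-free code to evaluating the function \<open>run\<close>; every
  loop body without an inner loop is verified this way.\<close>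

lemma ht_run:
  assumes "loop_free c" "cost c \<le> T" "Q (fst (run c (R, M))) (snd (run c (R, M)))"
  shows "ht c T R M Q"
  using ht_mono[OF ht_loop_free[OF assms(1) prod.collapse[symmetric]] assms(2)] assms(3) by blast

text \<open>Compiled at address 0, the code ends at its own length, which is exactly the halting
  condition.\<close>

lemma ht_answers_within:
  assumes "ht c T (\<lambda>_. 0) (\<lambda>i. if i < length w then w ! i else 0)
    (\<lambda>R M. R 0 = (if b then 1 else 0))"
  shows "answers_within (compile 0 c) w b T"
proof -
  have "code_at (compile 0 c) 0 (compile 0 c)" by (simp add: code_at_def)
  then show ?thesis
    using assms unfolding ht_def answers_within_def initial_def Let_def halted_def
    by (fastforce simp: halted_def)
qed

section \<open>Avoidable edges and components\<close>

lemma induced_cycle_adj: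
  assumes "induced_cycle V E c" "i < length c" "j < length c"
  shows "{c ! i, c ! j} \<in> E \<longleftrightarrow> j = Suc i mod length c \<or> i = Suc j mod length c"
  using assms unfolding induced_cycle_def by blast

text \<open>Adjacency depends only on cyclic succession of indices, which a common shift modulo the
  length preserves and reflects.\<close>

lemma induced_cycle_rotate1:
  assumes "induced_cycle V E c"
  shows "induced_cycle V E (rotate1 c)"
proof -
  have len: "3 \<le> length c" using assms by (simp add: induced_cycle_def)
  have "{rotate1 c ! i, rotate1 c ! j} \<in> E \<longleftrightarrow> j = Suc i mod length c \<or> i = Suc j mod length c"
    if i: "i < length c" and j: "j < length c" for i j
  proof -
    have "{c ! (Suc i mod length c), c ! (Suc j mod length c)} \<in> E \<longleftrightarrow>
        Suc j mod length c = Suc (Suc i mod length c) mod length c \<or>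
        Suc i mod length c = Suc (Suc j mod length c) mod length c"
      using len by (intro induced_cycle_adj[OF assms] mod_less_divisor) auto
    moreover have "Suc b mod length c = Suc (Suc a mod length c) mod length c \<longleftrightarrow> b = Suc a mod length c"
      if "a < length c" "b < length c" for a b
      using that len by (auto simp: mod_Suc split: if_splits)
    ultimately show ?thesis using i j by (simp add: nth_rotate1)
  qed
  then show ?thesis using assms by (simp add: induced_cycle_def)
qed

lemma induced_cycle_rotate: "induced_cycle V E c \<Longrightarrow> induced_cycle V E (rotate k c)"
  by (induction k) (auto simp: induced_cycle_rotate1)

lemma induced_cycle_rev:
  assumes "induced_cycle V E c"
  shows "induced_cycle V E (rev c)"
proof -
  have len: "3 \<le> length c" using assms by (simp add: induced_cycle_def)
  have "{rev c ! i, rev c ! j} \<in> E \<longleftrightarrow> j = Suc i mod length c \<or> i = Suc j mod length c"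
    if i: "i < length c" and j: "j < length c" for i j
  proof -
    let ?r = "\<lambda>i. length c - Suc i"
    have "{c ! ?r i, c ! ?r j} \<in> E \<longleftrightarrow>
        ?r j = Suc (?r i) mod length c \<or> ?r i = Suc (?r j) mod length c"
      using len i j by (intro induced_cycle_adj[OF assms]) auto
    moreover have "?r b = Suc (?r a) mod length c \<longleftrightarrow> a = Suc b mod length c"
      if "a < length c" "b < length c" for a b
      using that len by (auto simp: mod_Suc split: if_splits)
    ultimately show ?thesis using i j by (auto simp: rev_nth)
  qed
  then show ?thesis using assms by (simp add: induced_cycle_def)
qed

text \<open>Rotation brings \<open>y\<close> to the front; its neighbour \<open>x\<close> is then
  second or last, and in the latter case a reflection makes it second.\<close>

lemma induced_cycle_normalize:
  assumes c: "induced_cycle V E c" and "x \<in> set c" "y \<in> set c" "{x, y} \<in> E"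
  obtains c' where "induced_cycle V E c'" "set c' = set c" "c' ! 0 = y" "c' ! 1 = x"
proof -
  have len: "3 \<le> length c" using c by (simp add: induced_cycle_def)
  obtain k where k: "k < length c" "c ! k = y" using assms by (auto simp: in_set_conv_nth)
  define d where "d = rotate k c"
  have d: "induced_cycle V E d" "set d = set c" "length d = length c" "d ! 0 = y"
    using c k len nth_rotate[of 0 c k] by (cases "c = []"; auto simp: d_def induced_cycle_rotate)+
  obtain j where j: "j < length c" "d ! j = x" using assms d by (metis in_set_conv_nth)
  have "{d ! j, d ! 0} \<in> E" using j d assms by simp
  then have "0 = Suc j mod length c \<or> j = Suc 0 mod length c"
    using induced_cycle_adj[OF d(1), of j 0] d(3) j len by (cases "c = []") auto
  then consider "j = 1" | "j = length c - 1"
    using len j by (auto simp: mod_Suc split: if_splits)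
  then show thesis
  proof cases
    case 1
    then show ?thesis using d j that by blast
  next
    case 2
    \<comment> \<open>Reversal puts \<open>x\<close> first and \<open>y\<close> last; rotating by
      all but one position then moves \<open>y\<close> directly in front of
      \<open>x\<close>.\<close>
    let ?e = "rotate (length c - 1) (rev d)"
    have "?e ! 0 = y"
      using d len by (subst nth_rotate) (auto simp: rev_nth)
    moreover have "?e ! 1 = x"
      using d len j 2 by (cases "c = []"; subst nth_rotate) (auto simp: rev_nth)
    moreover have "induced_cycle V E ?e" "set ?e = set c"
      using d by (auto simp: induced_cycle_rotate induced_cycle_rev)
    ultimately show ?thesis using that by blast
  qed
qed

section \<open>Induced cycles through a \<open>P4\<close> and components outside the
  neighbourhoods\<close>

definition closed_nbhd :: "'a set set \<Rightarrow> 'a \<Rightarrow> 'a set" where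
  "closed_nbhd E x = {v. v = x \<or> {x, v} \<in> E}"

text \<open>The reflexive transitive closure is the same-component relation on \<open>S\<close>. A
  vertex outside \<open>S\<close> is related only to itself, matching a vertex that keeps its own
  label.\<close>

definition edge_rel :: "'a set set \<Rightarrow> 'a set \<Rightarrow> ('a \<times> 'a) set" where
  "edge_rel E S = {(u, v). {u, v} \<in> E \<and> u \<in> S \<and> v \<in> S}"

text \<open>Closed neighbourhoods exclude \<open>a = y\<close> and \<open>b = x\<close>; together
  with the edge \<open>{x, y}\<close> they also exclude \<open>a = x\<close> and
  \<open>b = y\<close>.\<close>

lemma P4_iff:
  assumes "ugraph V E"
  shows "P4 V E [a, x, y, b] \<longleftrightarrow> {x, y} \<in> E \<and>
    a \<in> closed_nbhd E x - closed_nbhd E y \<and> b \<in> closed_nbhd E y - closed_nbhd E x \<and> {a, b} \<notin> E"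
proof -
  have E: "{u, v} \<in> E \<Longrightarrow> u \<in> V \<and> v \<in> V \<and> u \<noteq> v" for u v
    using assms by (auto simp: ugraph_def)
  have nE: "{u} \<notin> E" for u using E[of u u] by auto
  have swap: "{x, a} = {a, x}" "{y, a} = {a, y}" "{b, a} = {a, b}" "{y, x} = {x, y}"
    "{b, x} = {x, b}" "{b, y} = {y, b}" by auto
  have "P4 V E [a, x, y, b] \<longleftrightarrow> distinct [a, x, y, b] \<and> {a, x, y, b} \<subseteq> V \<and>
     {a, x} \<in> E \<and> {x, y} \<in> E \<and> {y, b} \<in> E \<and> {a, y} \<notin> E \<and> {a, b} \<notin> E \<and> {x, b} \<notin> E"
    by (simp add: P4_def induced_path_def numeral_eq_Suc All_less_Suc nE swap) argo
  also have "\<dots> \<longleftrightarrow> {x, y} \<in> E \<and>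
    a \<in> closed_nbhd E x - closed_nbhd E y \<and> b \<in> closed_nbhd E y - closed_nbhd E x \<and> {a, b} \<notin> E"
    using E by (auto simp: closed_nbhd_def insert_commute)
  finally show ?thesis .
qed

text \<open>In the normalized cycle \<open>y, x, a, ..., b\<close> the absence of chords fixes the
  positions of \<open>a\<close> and \<open>b\<close>, and everything between them misses both closed
  neighbourhoods.\<close>

lemma connected_if_in_induced_cycle:
  assumes g: "ugraph V E" and P: "P4 V E [a, x, y, b]"
    and c: "induced_cycle V E c" "set [a, x, y, b] \<subseteq> set c"
  defines "W \<equiv> - (closed_nbhd E x \<union> closed_nbhd E y)"
  shows "\<exists>w w'. w \<in> W \<and> w' \<in> W \<and> {a, w} \<in> E \<and> {w', b} \<in> E \<and> (w, w') \<in> (edge_rel E W)\<^sup>*"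
proof -
  note P4_iff[OF g, THEN iffD1, OF P]
  then have xy: "{x, y} \<in> E" and ab: "a \<noteq> x" "a \<noteq> y" "b \<noteq> x" "b \<noteq> y" "a \<noteq> b"
    "{x, a} \<in> E" "{y, b} \<in> E" "{a, b} \<notin> E" "{y, a} \<notin> E"
    by (auto simp: closed_nbhd_def insert_commute)
  from induced_cycle_normalize[OF c(1) _ _ xy] c(2) obtain h where
    h: "induced_cycle V E h" "set h = set c" "h ! 0 = y" "h ! 1 = x" by auto
  define N where "N = length h"
  have N3: "3 \<le> N" and inj: "distinct h" using h by (auto simp: induced_cycle_def N_def)
  have adj: "{h ! i, h ! j} \<in> E \<longleftrightarrow> j = Suc i mod N \<or> i = Suc j mod N" if "i < N" "j < N" for i j
    using h that by (auto simp: induced_cycle_def N_def)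
  obtain i where i: "i < N" "h ! i = a" using c h by (metis N_def in_set_conv_nth list.set_intros(1) subsetD)
  obtain j where j: "j < N" "h ! j = b" using c h by (metis N_def in_set_conv_nth list.set_intros subsetD)
  have "i \<noteq> 0" "j \<noteq> 1" "j \<noteq> 0" using h i j ab by metis+
  have "{h ! 1, h ! i} \<in> E" using i h ab by simp
  then have i2: "i = 2" using adj[of 1 i] i N3 \<open>i \<noteq> 0\<close> by (auto simp: mod_Suc split: if_splits)
  have "{h ! 0, h ! j} \<in> E" using j h ab by simp
  then have jN: "j = N - 1" using adj[of 0 j] j N3 \<open>j \<noteq> 1\<close> by (auto simp: mod_Suc split: if_splits)
  have "i \<noteq> j" using i j ab by auto
  moreover have "{h ! i, h ! j} \<notin> E" using i j ab by simp
  \<comment> \<open>\<open>N = 3\<close> would identify \<open>a\<close> with \<open>b\<close>, and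
    \<open>N = 4\<close> would make them adjacent.\<close>
  ultimately have N5: "5 \<le> N" using adj[of i j] i j i2 jN N3 by (cases "N = 4") auto
  have W: "h ! k \<in> W" if "3 \<le> k" "k \<le> N - 2" for k
  proof -
    have k: "k < N" using that N5 by simp
    have "{h ! 1, h ! k} \<notin> E" "{h ! 0, h ! k} \<notin> E"
      using adj[of 1 k] adj[of 0 k] that N5 by (auto simp: mod_Suc split: if_splits)
    moreover have "h ! k \<noteq> h ! 1" "h ! k \<noteq> h ! 0"
      using nth_eq_iff_index_eq[OF inj, of k 1] nth_eq_iff_index_eq[OF inj, of k 0] k that N5
      by (cases "h = []"; auto simp: N_def)+
    ultimately show ?thesis using h by (auto simp: W_def closed_nbhd_def)
  qed
  have "(h ! 3, h ! (3 + k)) \<in> (edge_rel E W)\<^sup>*" if "3 + k \<le> N - 2" for k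
    using that
  proof (induction k)
    case 0
    then show ?case by simp
  next
    case (Suc k)
    have "{h ! (3 + k), h ! (3 + Suc k)} \<in> E"
      using adj[of "3 + k" "3 + Suc k"] Suc.prems N5 by simp
    then have "(h ! (3 + k), h ! (3 + Suc k)) \<in> edge_rel E W"
      using W[of "3 + k"] W[of "3 + Suc k"] Suc.prems by (simp add: edge_rel_def)
    moreover have "(h ! 3, h ! (3 + k)) \<in> (edge_rel E W)\<^sup>*" using Suc by simp
    ultimately show ?case by (rule rtrancl_into_rtrancl[rotated])
  qed
  \<comment> \<open>The indices \<open>3\<close> and \<open>N - 2\<close> are the inner neighbours
    of \<open>a\<close> and \<open>b\<close>; for \<open>N = 5\<close> they coincide and the walk is
    trivial.\<close>
  from this[of "N - 5"] have "(h ! 3, h ! (N - 2)) \<in> (edge_rel E W)\<^sup>*" using N5 by simp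
  moreover have "h ! 3 \<in> W" "h ! (N - 2) \<in> W" using W N5 by auto
  moreover have "{h ! 2, h ! 3} \<in> E" "{h ! (N - 2), h ! (N - 1)} \<in> E"
    using adj[of 2 3] adj[of "N - 2" "N - 1"] N5 by auto
  ultimately show ?thesis using i j i2 jN by blast
qed

text \<open>In a walk of least length a repeated vertex or a chord would give a shortcut.\<close>

lemma shortest_walk_induced:
  assumes "(a, b) \<in> S\<^sup>*" "sym S" "irrefl S"
  obtains f k where "f 0 = a" "f k = b" "inj_on f {..k}"
    "\<And>i j. i \<le> k \<Longrightarrow> j \<le> k \<Longrightarrow> (f i, f j) \<in> S \<longleftrightarrow> j = Suc i \<or> i = Suc j"
proof -
  have ex: "\<exists>k. (a, b) \<in> S ^^ k" using assms(1) by (simp add: rtrancl_power)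
  define k where "k = (LEAST k. (a, b) \<in> S ^^ k)"
  have k: "(a, b) \<in> S ^^ k" using ex unfolding k_def by (rule LeastI_ex)
  have min: "k \<le> l" if "(a, b) \<in> S ^^ l" for l using that unfolding k_def by (rule Least_le)
  from k obtain f where f: "f 0 = a" "f k = b" "\<And>i. i < k \<Longrightarrow> (f i, f (Suc i)) \<in> S"
    by (auto simp: relpow_fun_conv)
  have seg: "(f i, f j) \<in> S ^^ (j - i)" if "i \<le> j" "j \<le> k" for i j
    unfolding relpow_fun_conv using that f by (intro exI[of _ "\<lambda>l. f (i + l)"]) auto
  have neq: "f i \<noteq> f j" if "i < j" "j \<le> k" for i j
  proof
    assume eq: "f i = f j"
    have "(a, f i) \<in> S ^^ i" "(f j, b) \<in> S ^^ (k - j)" using seg[of 0 i] seg[of j k] f that by auto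
    then have "(a, b) \<in> S ^^ (i + (k - j))" using eq by (auto simp: relpow_add)
    then show False using min that by fastforce
  qed
  have nadj: "(f i, f j) \<notin> S" if "Suc i < j" "j \<le> k" for i j
  proof
    assume e: "(f i, f j) \<in> S"
    have "(a, f i) \<in> S ^^ i" "(f j, b) \<in> S ^^ (k - j)" using seg[of 0 i] seg[of j k] f that by auto
    then have "(a, b) \<in> S ^^ (i + 1 + (k - j))" using e by (auto simp: relpow_add simp del: add_Suc_right)
    then show False using min that by fastforce
  qed
  have adj: "(f i, f j) \<in> S \<longleftrightarrow> j = Suc i \<or> i = Suc j" if "i \<le> k" "j \<le> k" for i j
  proof -
    consider "i = j" | "j = Suc i" | "i = Suc j" | "Suc i < j" | "Suc j < i" by linarith
    then show ?thesis
      using that assms(2,3) f(3)[of i] f(3)[of j] nadj[of i j] nadj[of j i]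
      by cases (auto simp: irrefl_def dest: symD)
  qed
  moreover have "inj_on f {..k}"
    by (rule inj_onI) (metis neq atMost_iff linorder_neqE_nat)
  ultimately show thesis using that f by blast
qed

text \<open>The shortest path is taken in \<open>W\<close> with only \<open>a\<close> and
  \<open>b\<close> added. Its interior therefore stays in \<open>W\<close>, and \<open>x\<close> and
  \<open>y\<close> each see just one end, so closing up creates no chord.\<close>

lemma in_induced_cycle_if_connected:
  assumes g: "ugraph V E" and P: "P4 V E [a, x, y, b]"
  defines "W \<equiv> - (closed_nbhd E x \<union> closed_nbhd E y)"
  assumes w: "w \<in> W" "w' \<in> W" "{a, w} \<in> E" "{w', b} \<in> E" "(w, w') \<in> (edge_rel E W)\<^sup>*"
  shows "\<exists>c. induced_cycle V E c \<and> set [a, x, y, b] \<subseteq> set c"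
proof -
  have E: "{u, v} \<in> E \<Longrightarrow> u \<in> V \<and> v \<in> V \<and> u \<noteq> v" for u v
    using g by (auto simp: ugraph_def)
  note P4_iff[OF g, THEN iffD1, OF P]
  then have xy: "{x, y} \<in> E" and ab: "a \<noteq> x" "a \<noteq> y" "b \<noteq> x" "b \<noteq> y" "a \<noteq> b"
    "{x, a} \<in> E" "{y, b} \<in> E" "{a, b} \<notin> E" "{y, a} \<notin> E" "{x, b} \<notin> E"
    by (auto simp: closed_nbhd_def insert_commute)
  define S where "S = edge_rel E (W \<union> {a, b})"
  have "edge_rel E W \<subseteq> S" by (auto simp: S_def edge_rel_def)
  then have "(w, w') \<in> S\<^sup>*" using w(5) rtrancl_mono by blast
  moreover have "(a, w) \<in> S" "(w', b) \<in> S" using w by (auto simp: S_def edge_rel_def)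
  ultimately have "(a, b) \<in> S\<^sup>*" by (meson converse_rtrancl_into_rtrancl rtrancl.rtrancl_into_rtrancl)
  moreover have "sym S" by (auto simp: S_def edge_rel_def sym_def insert_commute)
  moreover have "irrefl S" using E[of u u for u] by (auto simp: irrefl_def S_def edge_rel_def)
  ultimately obtain f k where f: "f 0 = a" "f k = b" "inj_on f {..k}"
    and S: "\<And>i j. i \<le> k \<Longrightarrow> j \<le> k \<Longrightarrow> (f i, f j) \<in> S \<longleftrightarrow> j = Suc i \<or> i = Suc j"
    by (rule shortest_walk_induced) blast
  have k1: "k \<ge> 1" using f ab by (cases k) auto
  have fS: "f i \<in> W \<union> {a, b}" if "i \<le> k" for i
  proof (cases "i < k")
    case True
    then have "(f i, f (Suc i)) \<in> S" using S[of i "Suc i"] by simp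
    then show ?thesis by (auto simp: S_def edge_rel_def)
  next
    case False
    then show ?thesis using that f by simp
  qed
  have fadj: "{f i, f j} \<in> E \<longleftrightarrow> j = Suc i \<or> i = Suc j" if "i \<le> k" "j \<le> k" for i j
    using S[OF that] fS that by (auto simp: S_def edge_rel_def)
  have fV: "f i \<in> V" if "i \<le> k" for i
    using fadj[of i "Suc i"] fadj[of "i - 1" i] that k1 E by (cases "i = k") (auto dest!: E)
  have fint: "f i \<in> W" if "0 < i" "i < k" for i
  proof -
    have "f i \<noteq> f 0" "f i \<noteq> f k" using f(3) that by (auto simp: inj_on_def)
    then show ?thesis using fS[of i] that f by auto
  qed
  have fx: "{x, f i} \<in> E \<longleftrightarrow> i = 0" if "i \<le> k" for i
    using fint[of i] that f ab by (cases "i = 0"; cases "i = k") (auto simp: W_def closed_nbhd_def)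
  have fy: "{y, f i} \<in> E \<longleftrightarrow> i = k" if "i \<le> k" for i
    using fint[of i] that f ab by (cases "i = 0"; cases "i = k") (auto simp: W_def closed_nbhd_def)
  have fne: "f i \<noteq> x" "f i \<noteq> y" if "i \<le> k" for i
    using fS[OF that] ab by (auto simp: W_def closed_nbhd_def)
  \<comment> \<open>With \<open>y, x\<close> in front, \<open>f i\<close> sits at index
    \<open>i + 2\<close>, and the wrap-around edge is the one from \<open>b\<close> to
    \<open>y\<close>.\<close>
  define c where "c = y # x # map f [0..<Suc k]"
  have len: "length c = k + 3" by (simp add: c_def)
  have c0: "c ! 0 = y" "c ! 1 = x" by (simp_all add: c_def)
  have cf: "c ! (i + 2) = f i" if "i \<le> k" for i
    using that by (simp add: c_def del: upt_Suc)
  have nE: "{u, u} \<notin> E" for u using E[of u u] by blast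
  have "{c ! i, c ! j} \<in> E \<longleftrightarrow> j = Suc i mod length c \<or> i = Suc j mod length c"
    if "i < length c" "j < length c" for i j
  proof -
    have cases: "l = 0 \<or> l = 1 \<or> (\<exists>m\<le>k. l = m + 2)" if "l < length c" for l
      using that len by (cases "l < 2") (auto intro: exI[of _ "l - 2"])
    have mod: "Suc l mod length c = (if l = k + 2 then 0 else Suc l)" if "l < length c" for l
      using that len by (simp add: mod_Suc)
    have yx: "{y, x} \<in> E" using xy by (simp add: insert_commute)
    have fx': "{f m, x} \<in> E \<longleftrightarrow> m = 0" and fy': "{f m, y} \<in> E \<longleftrightarrow> m = k" if "m \<le> k" for m
      using fx[OF that] fy[OF that] by (simp_all add: insert_commute)
    from cases[OF that(1)] show ?thesis
    proof (elim disjE exE conjE)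
      assume i: "i = 0"
      from cases[OF that(2)] show ?thesis
        by (elim disjE exE conjE) (use that in \<open>simp_all only: i mod c0 cf fy nE yx, auto\<close>)
    next
      assume i: "i = 1"
      from cases[OF that(2)] show ?thesis
        by (elim disjE exE conjE) (use that k1 in \<open>simp_all only: i mod c0 cf fx nE xy, auto\<close>)
    next
      fix m assume i: "m \<le> k" "i = m + 2"
      from cases[OF that(2)] show ?thesis
        by (elim disjE exE conjE) (use that i(1) in \<open>simp_all only: i mod c0 cf fx' fy' fadj, auto\<close>)
    qed
  qed
  moreover have "x \<notin> f ` {0..<Suc k}" "y \<notin> f ` {0..<Suc k}"
    using fne by (metis atLeastLessThan_iff imageE less_Suc_eq_le)+
  then have "distinct c"
    using f(3) E[OF xy]
    by (auto simp add: c_def distinct_map atLeast0LessThan lessThan_Suc_atMost simp del: upt_Suc)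
  moreover have "set c \<subseteq> V" using fV E[OF xy] by (auto simp: c_def simp del: upt_Suc)
  ultimately have "induced_cycle V E c" by (simp add: induced_cycle_def len)
  moreover have "set [a, x, y, b] \<subseteq> set c"
    using f(1,2) by (force simp: c_def simp del: upt_Suc)
  ultimately show ?thesis by blast
qed

lemma P4_rev: "P4 V E [a, u, v, b] \<Longrightarrow> P4 V E [b, v, u, a]"
  by (simp add: P4_def induced_path_def numeral_eq_Suc All_less_Suc) metis

text \<open>The simplicial alternative is the vacuous case of the cycle condition. A
  \<open>P4\<close> that traverses the edge as \<open>y, x\<close> is turned round, so a single
  orientation remains.\<close>

lemma avoidable_edge_iff:
  assumes g: "ugraph V E" and xy: "{x, y} \<in> E"
  defines "W \<equiv> - (closed_nbhd E x \<union> closed_nbhd E y)"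
  shows "avoidable_edge V E {x, y} \<longleftrightarrow>
    (\<forall>a b. a \<in> closed_nbhd E x - closed_nbhd E y \<longrightarrow> b \<in> closed_nbhd E y - closed_nbhd E x \<longrightarrow>
       {a, b} \<in> E \<or> (\<exists>w w'. w \<in> W \<and> w' \<in> W \<and> {a, w} \<in> E \<and> {w', b} \<in> E \<and> (w, w') \<in> (edge_rel E W)\<^sup>*))"
    (is "_ \<longleftrightarrow> ?R")
proof -
  let ?C = "\<lambda>p. \<exists>c. induced_cycle V E c \<and> set p \<subseteq> set c"
  have "avoidable_edge V E {x, y} \<longleftrightarrow> (\<forall>p. P4 V E p \<and> middle_edge p = {x, y} \<longrightarrow> ?C p)"
    using xy by (auto simp: avoidable_edge_def simplicial_edge_def)
  also have "\<dots> \<longleftrightarrow> (\<forall>a b. P4 V E [a, x, y, b] \<longrightarrow> ?C [a, x, y, b])"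
  proof
    assume L: "\<forall>p. P4 V E p \<and> middle_edge p = {x, y} \<longrightarrow> ?C p"
    then show "\<forall>a b. P4 V E [a, x, y, b] \<longrightarrow> ?C [a, x, y, b]"
      by (intro allI impI L[rule_format]) (simp add: middle_edge_def)
  next
    assume R: "\<forall>a b. P4 V E [a, x, y, b] \<longrightarrow> ?C [a, x, y, b]"
    show "\<forall>p. P4 V E p \<and> middle_edge p = {x, y} \<longrightarrow> ?C p"
    proof (intro allI impI, elim conjE)
      fix p assume p: "P4 V E p" "middle_edge p = {x, y}"
      then have "length p = Suc (Suc (Suc (Suc 0)))" by (simp add: P4_def)
      then obtain a u v b where abuv: "p = [a, u, v, b]"
        by (auto simp only: length_Suc_conv length_0_conv)
      then have "u = x \<and> v = y \<or> u = y \<and> v = x"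
        using p by (auto simp: middle_edge_def doubleton_eq_iff)
      moreover have "P4 V E [b, v, u, a]"
        using p(1) unfolding abuv by (rule P4_rev)
      ultimately show "?C p"
      proof (elim disjE conjE)
        assume "u = x" "v = y"
        then show ?thesis using R[rule_format, of a b] p(1) abuv by simp
      next
        assume "u = y" "v = x" "P4 V E [b, v, u, a]"
        then have "?C [b, x, y, a]" using R[rule_format, of b a] by simp
        moreover have "set [b, x, y, a] = set p" using abuv \<open>u = y\<close> \<open>v = x\<close> by auto
        ultimately show ?thesis by (simp only:)
      qed
    qed
  qed
  also have "\<dots> \<longleftrightarrow> ?R"
  proof -
    let ?K = "\<lambda>a b. \<exists>w w'. w \<in> W \<and> w' \<in> W \<and> {a, w} \<in> E \<and> {w', b} \<in> E \<and> (w, w') \<in> (edge_rel E W)\<^sup>*"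
    have CK: "?C [a, x, y, b] \<longleftrightarrow> ?K a b" if P: "P4 V E [a, x, y, b]" for a b
    proof
      assume "?C [a, x, y, b]"
      then obtain c where "induced_cycle V E c" "set [a, x, y, b] \<subseteq> set c" by (elim exE conjE)
      from connected_if_in_induced_cycle[OF g P this] show "?K a b" unfolding W_def .
    next
      assume "?K a b"
      then obtain w w' where "w \<in> W" "w' \<in> W" "{a, w} \<in> E" "{w', b} \<in> E" "(w, w') \<in> (edge_rel E W)\<^sup>*"
        by (elim exE conjE)
      from in_induced_cycle_if_connected[OF g P this[unfolded W_def]] show "?C [a, x, y, b]" .
    qed
    have "(P4 V E [a, x, y, b] \<longrightarrow> ?C [a, x, y, b]) \<longleftrightarrow>
        (a \<in> closed_nbhd E x - closed_nbhd E y \<longrightarrow> b \<in> closed_nbhd E y - closed_nbhd E x \<longrightarrow>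
          {a, b} \<in> E \<or> ?K a b)" for a b
    proof (cases "P4 V E [a, x, y, b]")
      case True
      then show ?thesis using P4_iff[OF g, of a x y b] by (simp only: CK[OF True]) simp
    next
      case False
      moreover from this have "\<not> (a \<in> closed_nbhd E x - closed_nbhd E y \<and>
          b \<in> closed_nbhd E y - closed_nbhd E x \<and> {a, b} \<notin> E)"
        using P4_iff[OF g, of a x y b] xy by simp
      ultimately show ?thesis by argo
    qed
    then show ?thesis by (simp only:)
  qed
  finally show ?thesis .
qed

section \<open>The algorithm\<close>

text \<open>
  Registers: 0 holds the answer, 1 the constant 1, 2 the number of vertices, 4 and 5 the vertices
  \<open>x\<close> and \<open>y\<close>, 9 the counter of the vertex loops; 10 and 11 hold the current arc \<open>(u, v)\<close> and 12 the read
  position in the edge list; 13 and 16 are the loop tests, the rest is scratch. Registers 3, 6, 7, 8 point to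
  four arrays placed behind the input: \<open>X\<close> and \<open>Y\<close> (indicators of the closed neighbourhoods of \<open>x\<close> and
  \<open>y\<close>), \<open>L\<close> (component labels) and \<open>K\<close> (marks on labels). In round \<open>a\<close> a label is marked by
  writing \<open>a + 1\<close>, so that \<open>K\<close> never has to be cleared, which would cost \<open>n\<close> steps per round.
\<close>

text \<open>Register \<open>t\<close> becomes 0 iff \<open>u\<close> and \<open>v\<close> hold the same number; \<open>s\<close> must differ from
  \<open>u\<close> and \<open>v\<close>, while \<open>t\<close> may be \<open>u\<close>.\<close>

definition test_eq :: "reg \<Rightarrow> reg \<Rightarrow> reg \<Rightarrow> reg \<Rightarrow> com" where
  "test_eq t s u v = (Ins (Sub s u v) ;; Ins (Sub t v u) ;; Ins (Add t t s))"

definition fetch :: "reg \<Rightarrow> reg \<Rightarrow> reg \<Rightarrow> com" where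
  "fetch r base i = (Ins (Add 18 base i) ;; Ins (Load r 18))"

text \<open>Every listed edge is processed in both orientations.\<close>

definition edge_loop :: "com \<Rightarrow> com" where
  "edge_loop B = (Ins (Const 12 4) ;; Ins (Sub 13 3 12)) ;;
     While 13 ((Ins (Load 10 12) ;; Ins (Add 12 12 1) ;; Ins (Load 11 12) ;; Ins (Add 12 12 1)) ;;
       B ;; (Ins (Copy 17 10) ;; Ins (Copy 10 11) ;; Ins (Copy 11 17)) ;; B ;; Ins (Sub 13 3 12))"

text \<open>The counter is reset at the end because the next vertex loop starts from it without
  initialization. One counter suffices since vertex loops are never nested.\<close>

definition vertex_loop :: "com \<Rightarrow> com" where
  "vertex_loop B = Ins (Sub 16 2 9) ;; While 16 (B ;; (Ins (Add 9 9 1) ;; Ins (Sub 16 2 9))) ;;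
     Ins (Const 9 0)"

text \<open>Registers 0 and 1 first serve as the addresses 0 and 1 of \<open>n\<close> and the edge
  count. The stores enter \<open>x\<close> into \<open>X\<close> and \<open>y\<close> into
  \<open>Y\<close>, and the answer starts as true.\<close>

definition preamble :: com where
  "preamble = Ins (Const 1 1) ;; Ins (Load 2 0) ;; Ins (Load 17 1) ;; Ins (Const 18 4) ;;
     Ins (Add 3 17 17) ;; Ins (Add 3 3 18) ;; Ins (Const 18 2) ;; Ins (Load 4 18) ;;
     Ins (Const 18 3) ;; Ins (Load 5 18) ;; Ins (Add 6 3 2) ;; Ins (Add 7 6 2) ;; Ins (Add 8 7 2) ;;
     Ins (Add 18 3 4) ;; Ins (Store 18 1) ;; Ins (Add 18 6 5) ;; Ins (Store 18 1) ;; Ins (Const 0 1)"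

definition nbhd_body :: com where
  "nbhd_body = test_eq 17 19 10 4 ;; IfZ 17 (Ins (Add 18 3 11) ;; Ins (Store 18 1)) ;;
     test_eq 17 19 10 5 ;; IfZ 17 (Ins (Add 18 6 11) ;; Ins (Store 18 1))"

definition init_body :: com where
  "init_body = Ins (Add 18 7 9) ;; Ins (Store 18 9)"

text \<open>\<open>fetch\<close> leaves its address in register 18, so the store overwrites the
  label just read.\<close>

definition relabel_body :: com where
  "relabel_body = fetch 17 7 9 ;; test_eq 17 19 17 15 ;; IfZ 17 (Ins (Store 18 14))"

text \<open>The sum of the four indicators is zero iff both ends of the arc lie in \<open>W\<close>.
  Both labels are saved in registers before the array changes.\<close>

definition merge_body :: com where
  "merge_body = (fetch 17 3 10 ;; fetch 19 6 10 ;; Ins (Add 17 17 19) ;;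
       fetch 19 3 11 ;; Ins (Add 17 17 19) ;; fetch 19 6 11 ;; Ins (Add 17 17 19)) ;;
     IfZ 17 ((fetch 14 7 10 ;; fetch 15 7 11) ;; vertex_loop relabel_body)"

definition mark_nbrs_body :: com where
  "mark_nbrs_body = test_eq 17 19 10 9 ;;
     IfZ 17 (fetch 18 7 11 ;; Ins (Add 18 8 18) ;; Ins (Add 14 9 1) ;; Ins (Store 18 14))"

definition mark_ends_body :: com where
  "mark_ends_body = fetch 17 3 10 ;; fetch 19 6 10 ;; Ins (Add 17 17 19) ;;
     IfZ 17 (fetch 18 7 10 ;; fetch 17 8 18 ;; Ins (Add 14 9 1) ;; test_eq 17 19 17 14 ;;
       IfZ 17 (fetch 18 7 11 ;; Ins (Add 18 8 18) ;; Ins (Store 18 14)))"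

definition check_body :: com where
  "check_body = test_eq 17 19 10 5 ;;
     IfZ 17 (fetch 17 3 11 ;;
       IfZ 17 (fetch 18 7 11 ;; fetch 17 8 18 ;; Ins (Add 14 9 1) ;; test_eq 17 19 17 14 ;;
         IfNZ 17 (Ins (Const 0 0))))"

definition vertex_body :: com where
  "vertex_body = fetch 17 3 9 ;;
     IfNZ 17 (fetch 17 6 9 ;;
       IfZ 17 (edge_loop mark_nbrs_body ;; edge_loop mark_ends_body ;; edge_loop check_body))"

definition avoidable_prog :: com where
  "avoidable_prog = preamble ;; edge_loop nbhd_body ;; vertex_loop init_body ;;
     edge_loop merge_body ;; vertex_loop vertex_body"

section \<open>Arcs and component labels\<close>

text \<open>The list follows the order in which \<open>edge_loop\<close> visits the arcs, so its
  prefixes describe the progress of a pass.\<close>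

definition arcs :: "('a \<times> 'a) list \<Rightarrow> ('a \<times> 'a) list" where
  "arcs es = concat (map (\<lambda>(u, v). [(u, v), (v, u)]) es)"

lemma set_arcs: "set (arcs es) = set es \<union> (set es)\<inverse>"
  by (auto simp: arcs_def)

lemma arcs_take_Suc:
  "i < length es \<Longrightarrow> arcs (take (Suc i) es) = arcs (take i es) @ [es ! i, prod.swap (es ! i)]"
  by (auto simp: arcs_def take_Suc_conv_app_nth split: prod.splits)

lemma arcs_split:
  assumes "i < length es"
  shows "arcs es = arcs (take i es) @ es ! i # prod.swap (es ! i) # arcs (drop (Suc i) es)"
proof -
  have "es = take i es @ es ! i # drop (Suc i) es" using assms by (rule id_take_nth_drop)
  then have "arcs es = arcs (take i es @ es ! i # drop (Suc i) es)" by (rule arg_cong)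
  also have "\<dots> = arcs (take i es) @ es ! i # prod.swap (es ! i) # arcs (drop (Suc i) es)"
    by (simp add: arcs_def case_prod_beta prod.swap_def)
  finally show ?thesis .
qed

definition relabel :: "nat \<Rightarrow> nat \<Rightarrow> (nat \<Rightarrow> nat) \<Rightarrow> nat \<Rightarrow> nat" where
  "relabel c d L = (\<lambda>w. if L w = d then c else L w)"

text \<open>The union step of a union-find structure with one explicit label per vertex: the class
  of \<open>v\<close> takes over the label of \<open>u\<close>.\<close>

definition merge :: "(nat \<Rightarrow> nat) \<Rightarrow> (nat \<Rightarrow> nat) \<Rightarrow> nat \<times> nat \<Rightarrow> (nat \<Rightarrow> nat) \<Rightarrow> nat \<Rightarrow> nat" where
  "merge X Y = (\<lambda>(u, v) L. if X u + Y u + X v + Y v = 0 then relabel (L u) (L v) L else L)"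

lemma fold_merge_snoc:
  "fold (merge X Y) (bs @ [(u, v)]) L = (let L' = fold (merge X Y) bs L in
     if X u + Y u + X v + Y v = 0 then relabel (L' u) (L' v) L' else L')"
  by (simp add: merge_def Let_def)

text \<open>Relabelling acts on labels alone, so equal labels never separate and a processed arc of
  \<open>S\<close> keeps its ends together. Conversely labels become equal only through arcs of
  \<open>S\<close>, whose symmetry allows them to be followed both ways.\<close>

lemma fold_merge_eq_iff:
  fixes as :: "(nat \<times> nat) list" and X Y :: "nat \<Rightarrow> nat"
  defines "S \<equiv> {(u, v) \<in> set as. X u = 0 \<and> Y u = 0 \<and> X v = 0 \<and> Y v = 0}"
  assumes "sym S"
  shows "fold (merge X Y) as id u = fold (merge X Y) as id v \<longleftrightarrow> (u, v) \<in> S\<^sup>*"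
proof -
  let ?L = "\<lambda>as. fold (merge X Y) as id"
  have sym: "(v, u) \<in> S\<^sup>*" if "(u, v) \<in> S\<^sup>*" for u v
    using that sym_rtrancl[OF assms(2)] by (rule symD[rotated])
  have sound: "?L bs u = ?L bs v \<Longrightarrow> (u, v) \<in> S\<^sup>*" if "set bs \<subseteq> set as" for bs u v
    using that
  proof (induction bs arbitrary: u v rule: rev_induct)
    case Nil
    then show ?case by simp
  next
    case (snoc e bs)
    obtain p q where e: "e = (p, q)" by fastforce
    have IH: "(u, v) \<in> S\<^sup>*" if "?L bs u = ?L bs v" for u v
      using snoc.IH[OF that] snoc.prems(2) by simp
    show ?case
    proof (cases "X p + Y p + X q + Y q = 0")
      case True
      then have pq: "(p, q) \<in> S\<^sup>*" using snoc.prems(2) e by (auto simp: S_def)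
      have "relabel (?L bs p) (?L bs q) (?L bs) u = relabel (?L bs p) (?L bs q) (?L bs) v"
        using snoc.prems(1) True unfolding e fold_merge_snoc Let_def by (simp only: if_True simp_thms)
      \<comment> \<open>After a merge two labels agree if they did before, or if one was the label
        of \<open>q\<close> and the other that of \<open>p\<close>.\<close>
      then consider "?L bs u = ?L bs v" | "?L bs u = ?L bs q" "?L bs p = ?L bs v"
        | "?L bs v = ?L bs q" "?L bs p = ?L bs u"
        by (auto simp: relabel_def split: if_splits)
      then show ?thesis
      proof cases
        case 1
        then show ?thesis by (rule IH)
      next
        case 2
        with IH[of u q] IH[of p v] sym[OF pq] show ?thesis by (meson rtrancl_trans)
      next
        case 3
        with sym[OF IH[of v q]] sym[OF IH[of p u]] pq show ?thesis by (meson rtrancl_trans)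
      qed
    next
      case False
      then have "?L (bs @ [e]) = ?L bs" unfolding e fold_merge_snoc Let_def by (simp only: if_False)
      then show ?thesis using snoc.prems(1) by (intro IH) (simp only:)
    qed
  qed
  have processed: "?L bs u = ?L bs v" if "(u, v) \<in> set bs" "X u + Y u + X v + Y v = 0" for bs u v
    using that
  proof (induction bs rule: rev_induct)
    case (snoc e bs)
    obtain p q where e: "e = (p, q)" by fastforce
    show ?case
    proof (cases "(u, v) = e")
      case True
      then show ?thesis using snoc.prems(2)
        unfolding e fold_merge_snoc Let_def by (auto simp only: if_True relabel_def prod.inject split: if_split)
    next
      case False
      then have "(u, v) \<in> set bs" using snoc.prems(1) by auto
      then have "?L bs u = ?L bs v" using snoc.IH snoc.prems(2) by blast
      then show ?thesis unfolding e fold_merge_snoc Let_def relabel_def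
        by (simp only: split: if_split) blast
    qed
  qed simp
  have "?L as u = ?L as v" if "(u, v) \<in> S\<^sup>*" for u v
    using that
  proof (induction rule: rtrancl_induct)
    case (step v w)
    then have "?L as v = ?L as w" by (intro processed) (auto simp: S_def)
    with step.IH show ?case by (rule trans)
  qed (rule refl)
  then show ?thesis using sound[of as u v] by blast
qed

section \<open>Positions in the encoded input\<close>

lemma length_encode: "length (encode n es x y) = 4 + 2 * length es"
  by (induction es) (auto simp: encode_def)

lemma concat_pairs_nth:
  "i < length es \<Longrightarrow> concat (map (\<lambda>(u, v). [u, v]) es) ! (2 * i) = fst (es ! i) \<and>
     concat (map (\<lambda>(u, v). [u, v]) es) ! Suc (2 * i) = snd (es ! i)"
  by (induction es arbitrary: i) (auto simp: nth_Cons split: nat.splits)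

lemma encode_nth:
  "encode n es x y ! 0 = n" "encode n es x y ! 1 = length es"
  "encode n es x y ! 2 = x" "encode n es x y ! 3 = y"
  "i < length es \<Longrightarrow> encode n es x y ! (4 + 2 * i) = fst (es ! i)"
  "i < length es \<Longrightarrow> encode n es x y ! (5 + 2 * i) = snd (es ! i)"
  using concat_pairs_nth[of i es] by (auto simp: encode_def numeral_eq_Suc)

type_synonym data = "nat \<times> nat \<times> (nat \<Rightarrow> nat) \<times> (nat \<Rightarrow> nat) \<times> (nat \<Rightarrow> nat) \<times> (nat \<Rightarrow> nat)"

section \<open>Memory layout and rules for the two kinds of loops\<close>

locale edge_instance =
  fixes n :: nat and es :: "(nat \<times> nat) list" and x y :: nat
  assumes es_less: "(u, v) \<in> set es \<Longrightarrow> u < n \<and> v < n"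
    and x_less: "x < n" and y_less: "y < n" and x_neq_y: "x \<noteq> y"
begin

definition base :: nat where "base = 4 + 2 * length es"

text \<open>The components of the data are the answer, the vertex counter and the arrays
  \<open>X\<close>, \<open>Y\<close>, \<open>L\<close>, \<open>K\<close>. Labels are used as indices into \<open>K\<close>, hence the bound on \<open>L\<close>.\<close>

definition rep :: "data \<Rightarrow> (reg \<Rightarrow> nat) \<Rightarrow> (nat \<Rightarrow> nat) \<Rightarrow> bool" where
  "rep s R M \<longleftrightarrow> (case s of (f, a, X, Y, L, K) \<Rightarrow>
     R 0 = f \<and> R 1 = 1 \<and> R 2 = n \<and> R 3 = base \<and> R 4 = x \<and> R 5 = y \<and>
     R 6 = base + n \<and> R 7 = base + n + n \<and> R 8 = base + n + n + n \<and> R 9 = a \<and>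
     (\<forall>i<length es. M (4 + 2 * i) = fst (es ! i) \<and> M (5 + 2 * i) = snd (es ! i)) \<and>
     (\<forall>v<n. M (base + v) = X v \<and> M (base + n + v) = Y v \<and> M (base + n + n + v) = L v \<and>
        M (base + n + n + n + v) = K v \<and> L v < n))"

lemma rep_reg [simp]: "10 \<le> r \<Longrightarrow> rep s (R(r := k)) M \<longleftrightarrow> rep s R M"
  by (auto simp: rep_def split: prod.splits)

lemma rep_flag [simp]: "rep (f, a, X, Y, L, K) R M \<Longrightarrow> rep (g, a, X, Y, L, K) (R(0 := g)) M"
  by (auto simp: rep_def)

lemma rep_vertex [simp]: "rep (f, a, X, Y, L, K) R M \<Longrightarrow> rep (f, b, X, Y, L, K) (R(9 := b)) M"
  by (auto simp: rep_def)

lemma rep_regs: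
  assumes "rep (f, a, X, Y, L, K) R M"
  shows "R 0 = f" "R 1 = 1" "R (Suc 0) = 1" "R 2 = n" "R 3 = base" "R 4 = x" "R 5 = y"
    "R 6 = base + n" "R 7 = base + n + n" "R 8 = base + n + n + n" "R 9 = a"
  using assms by (auto simp: rep_def)

lemma rep_mem:
  assumes "rep (f, a, X, Y, L, K) R M" "v < n"
  shows "M (base + v) = X v" "M (base + n + v) = Y v" "M (base + n + n + v) = L v"
    "M (base + n + n + n + v) = K v" "L v < n"
  using assms by (auto simp: rep_def)

lemma rep_edge:
  assumes "rep s R M" "i < length es"
  shows "M (4 + 2 * i) = fst (es ! i)" "M (5 + 2 * i) = snd (es ! i)"
  using assms by (auto simp: rep_def)

text \<open>The edge list and the four arrays occupy disjoint intervals of memory, so a store at an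
  index below \<open>n\<close> touches one array entry only.\<close>

lemma rep_store:
  assumes "rep (f, a, X, Y, L, K) R M" "v < n"
  shows "rep (f, a, X(v := k), Y, L, K) R (M(base + v := k))"
    and "rep (f, a, X, Y(v := k), L, K) R (M(base + n + v := k))"
    and "k < n \<Longrightarrow> rep (f, a, X, Y, L(v := k), K) R (M(base + n + n + v := k))"
    and "rep (f, a, X, Y, L, K(v := k)) R (M(base + n + n + n + v := k))"
  using assms by (auto simp: rep_def base_def)

text \<open>What an edge loop relies on across its body: the arc, which is swapped for the second
  run, and the read position, from which the loop test is recomputed.\<close>

definition keeps :: "(reg \<Rightarrow> nat) \<Rightarrow> (reg \<Rightarrow> nat) \<Rightarrow> bool" where
  "keeps R R' \<longleftrightarrow> R' 10 = R 10 \<and> R' 11 = R 11 \<and> R' 12 = R 12"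

lemma arcs_less: "(u, v) \<in> set (arcs es) \<Longrightarrow> u < n \<and> v < n"
  using es_less by (auto simp: set_arcs)

text \<open>\<open>G\<close> maps the arcs processed so far to the data reached, so a pass is
  verified by the effect of appending one arc. An edge costs two runs of \<open>B\<close> and 10
  further steps.\<close>

lemma ht_edge_loop:
  assumes body: "\<And>d u v r R M. arcs es = d @ (u, v) # r \<Longrightarrow> rep (G d) R M \<Longrightarrow> R 10 = u \<Longrightarrow> R 11 = v \<Longrightarrow>
      ht B T R M (\<lambda>R' M'. rep (G (d @ [(u, v)])) R' M' \<and> keeps R R')"
    and init: "rep (G []) R M"
  shows "ht (edge_loop B) (length es * (2 * T + 10) + 3) R M (rep (G (arcs es)))"
proof -
  let ?J = "\<lambda>i R M. rep (G (arcs (take i es))) R M \<and> R 12 = 4 + 2 * i \<and> R 13 = base - R 12"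
  have regs: "R 1 = 1" "R 3 = base" if "rep s R M" for s R M
    using that by (auto simp: rep_def)
  have step: "ht ((Ins (Load 10 12) ;; Ins (Add 12 12 1) ;; Ins (Load 11 12) ;; Ins (Add 12 12 1)) ;;
       B ;; (Ins (Copy 17 10) ;; Ins (Copy 10 11) ;; Ins (Copy 11 17)) ;; B ;; Ins (Sub 13 3 12))
       (4 + (T + (3 + (T + 1)))) R M (?J (Suc i))" if i: "i < length es" and J: "?J i R M" for i R M
  proof -
    obtain u v where uv: "es ! i = (u, v)" by fastforce
    let ?d = "arcs (take i es)"
    note split = arcs_split[OF i, unfolded uv prod.swap_def fst_conv snd_conv]
    have split2: "arcs es = (?d @ [(u, v)]) @ (v, u) # arcs (drop (Suc i) es)"
      using split by simp
    have last: "arcs (take (Suc i) es) = (?d @ [(u, v)]) @ [(v, u)]"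
      using arcs_take_Suc[OF i] uv by simp
    show ?thesis
    proof (rule ht_Seq)
      show "ht (Ins (Load 10 12) ;; Ins (Add 12 12 1) ;; Ins (Load 11 12) ;; Ins (Add 12 12 1)) 4 R M
        (\<lambda>R M. rep (G ?d) R M \<and> R 10 = u \<and> R 11 = v \<and> R 12 = 4 + 2 * Suc i)"
        using J regs(1)[OF conjunct1[OF J]] rep_edge[OF conjunct1[OF J] i] uv
        by (intro ht_run) (auto simp: Let_def algebra_simps numeral_eq_Suc)
    next
      fix R M assume 1: "rep (G ?d) R M \<and> R 10 = u \<and> R 11 = v \<and> R 12 = 4 + 2 * Suc i"
      show "ht (B ;; (Ins (Copy 17 10) ;; Ins (Copy 10 11) ;; Ins (Copy 11 17)) ;; B ;; Ins (Sub 13 3 12))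
        (T + (3 + (T + 1))) R M (?J (Suc i))"
      proof (rule ht_Seq)
        show "ht B T R M (\<lambda>R' M'. rep (G (?d @ [(u, v)])) R' M' \<and> R' 10 = u \<and> R' 11 = v \<and> R' 12 = 4 + 2 * Suc i)"
          using body[OF split, of R M] 1 by (auto simp: keeps_def elim!: ht_mono)
      next
        fix R M assume 2: "rep (G (?d @ [(u, v)])) R M \<and> R 10 = u \<and> R 11 = v \<and> R 12 = 4 + 2 * Suc i"
        show "ht ((Ins (Copy 17 10) ;; Ins (Copy 10 11) ;; Ins (Copy 11 17)) ;; B ;; Ins (Sub 13 3 12))
          (3 + (T + 1)) R M (?J (Suc i))"
        proof (rule ht_Seq)
          show "ht (Ins (Copy 17 10) ;; Ins (Copy 10 11) ;; Ins (Copy 11 17)) 3 R M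
            (\<lambda>R M. rep (G (?d @ [(u, v)])) R M \<and> R 10 = v \<and> R 11 = u \<and> R 12 = 4 + 2 * Suc i)"
            using 2 by (intro ht_run) (auto simp: Let_def)
        next
          fix R M assume 3: "rep (G (?d @ [(u, v)])) R M \<and> R 10 = v \<and> R 11 = u \<and> R 12 = 4 + 2 * Suc i"
          show "ht (B ;; Ins (Sub 13 3 12)) (T + 1) R M (?J (Suc i))"
          proof (rule ht_Seq)
            show "ht B T R M (\<lambda>R' M'. rep (G (arcs (take (Suc i) es))) R' M' \<and> R' 12 = 4 + 2 * Suc i)"
              using body[OF split2, of R M] 3 unfolding last by (auto simp: keeps_def elim!: ht_mono)
          next
            fix R M assume 4: "rep (G (arcs (take (Suc i) es))) R M \<and> R 12 = 4 + 2 * Suc i"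
            then show "ht (Ins (Sub 13 3 12)) 1 R M (?J (Suc i))"
              using regs(2)[OF conjunct1[OF 4]] by (intro ht_run) (auto simp: Let_def)
          qed
        qed
      qed
    qed
  qed
  have "ht (edge_loop B) (2 + (length es * (4 + (T + (3 + (T + 1))) + 2) + 1)) R M (?J (length es))"
    unfolding edge_loop_def
  proof (rule ht_Seq)
    show "ht (Ins (Const 12 4) ;; Ins (Sub 13 3 12)) 2 R M (?J 0)"
      using init regs(2)[OF init] by (intro ht_run) (auto simp: Let_def arcs_def)
  next
    fix R M assume "?J 0 R M"
    then show "ht (While 13 ((Ins (Load 10 12) ;; Ins (Add 12 12 1) ;; Ins (Load 11 12) ;; Ins (Add 12 12 1)) ;;
       B ;; (Ins (Copy 17 10) ;; Ins (Copy 10 11) ;; Ins (Copy 11 17)) ;; B ;; Ins (Sub 13 3 12)))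
       (length es * (4 + (T + (3 + (T + 1))) + 2) + 1) R M (?J (length es))"
      using step by (intro ht_While) (auto simp: base_def)
  qed
  then show ?thesis by (rule ht_mono) (auto simp: algebra_simps)
qed

text \<open>The body has to establish the invariant for the registers as they will be after the loop
  itself advances the counter and the test.\<close>

lemma ht_vertex_loop:
  assumes inv: "\<And>k R M. J k R M \<Longrightarrow> R 9 = k \<and> R 16 = n - k"
    and body: "\<And>k R M. k < n \<Longrightarrow> J k R M \<Longrightarrow>
      ht B T R M (\<lambda>R M. R 9 = k \<and> R 1 = 1 \<and> R 2 = n \<and> J (Suc k) (R(9 := Suc k, 16 := n - Suc k)) M)"
    and exit: "\<And>R M. J n R M \<Longrightarrow> Q (R(9 := 0)) M"
    and init: "R 9 = 0" "R 2 = n" "J 0 (R(16 := n)) M"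
  shows "ht (vertex_loop B) (n * (T + 4) + 3) R M Q"
proof -
  have "ht (vertex_loop B) (1 + (n * (T + 2 + 2) + 1 + 1)) R M Q"
    unfolding vertex_loop_def
  proof (rule ht_Seq)
    show "ht (Ins (Sub 16 2 9)) 1 R M (J 0)"
      using init by (intro ht_run) (auto simp: Let_def)
  next
    fix R M assume J0: "J 0 R M"
    show "ht (While 16 (B ;; Ins (Add 9 9 1) ;; Ins (Sub 16 2 9)) ;; Ins (Const 9 0))
      (n * (T + 2 + 2) + 1 + 1) R M Q"
    proof (rule ht_Seq)
      show "ht (While 16 (B ;; Ins (Add 9 9 1) ;; Ins (Sub 16 2 9))) (n * (T + 2 + 2) + 1) R M (J n)"
      proof (rule ht_While)
        fix k R M assume k: "k < n" and J: "J k R M"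
        have "ht (B ;; Ins (Add 9 9 1) ;; Ins (Sub 16 2 9)) (T + 2) R M (J (Suc k))"
          by (rule ht_Seq[OF body[OF k J]], rule ht_run) (auto simp: Let_def)
        then show "R 16 \<noteq> 0 \<and> ht (B ;; Ins (Add 9 9 1) ;; Ins (Sub 16 2 9)) (T + 2) R M (J (Suc k))"
          using inv[OF J] k by simp
      qed (use inv[of n] J0 in simp_all)
    next
      fix R M assume "J n R M"
      then show "ht (Ins (Const 9 0)) 1 R M Q"
        using exit by (intro ht_run) (auto simp: Let_def)
    qed
  qed
  then show ?thesis by (rule ht_mono) (auto simp: algebra_simps)
qed

text \<open>Labels matter only below \<open>n\<close>; thus a completed pass may be described by a
  function that differs beyond.\<close>

lemma rep_vertex_cong:
  assumes "rep (f, a, X, Y, L, K) R M" "\<And>v. v < n \<Longrightarrow> L v = L' v"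
  shows "rep (f, b, X, Y, L', K) (R(9 := b)) M"
  using assms by (auto simp: rep_def)

text \<open>\<open>test_eq\<close> adds two truncated differences; their vanishing amounts to two
  inequalities, which this turns back into an equation.\<close>

lemmas le_le_eq = order_class.order_eq_iff[symmetric, where 'a = nat]

section \<open>Computing neighbourhood indicators and component labels\<close>

lemma ht_nbhd_loop:
  assumes "rep (f, a, \<lambda>v. if v = x then 1 else 0, \<lambda>v. if v = y then 1 else 0, L, K) R M"
  shows "ht (edge_loop nbhd_body) (length es * 38 + 3) R M
    (rep (f, a, \<lambda>v. if v = x \<or> (x, v) \<in> set (arcs es) then 1 else 0,
       \<lambda>v. if v = y \<or> (y, v) \<in> set (arcs es) then 1 else 0, L, K))"
proof -
  let ?X = "\<lambda>z d v. if v = z \<or> (z, v) \<in> set d then 1 else 0"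
  let ?G = "\<lambda>d. (f, a, ?X x d, ?X y d, L, K)"
  have "ht (edge_loop nbhd_body) (length es * (2 * 14 + 10) + 3) R M (rep (?G (arcs es)))"
  proof (rule ht_edge_loop[where G = ?G])
    fix d u v r R M
    assume sp: "arcs es = d @ (u, v) # r" and rep: "rep (?G d) R M" and uv: "R 10 = u" "R 11 = v"
    have v: "v < n" using arcs_less[of u v] sp by simp
    \<comment> \<open>Appending an arc changes the indicator in at most one place, which matches a
      single store.\<close>
    have upd: "?X z (d @ [(u, v)]) = (if u = z then (?X z d)(v := 1) else ?X z d)" for z
      by (auto simp: fun_eq_iff)
    note r = rep_regs[OF rep]
    show "ht nbhd_body 14 R M (\<lambda>R' M'. rep (?G (d @ [(u, v)])) R' M' \<and> keeps R R')"
      unfolding upd using rep v x_neq_y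
      by (intro ht_run; cases "u = x"; cases "u = y")
        (auto simp: nbhd_body_def test_eq_def Let_def r uv keeps_def le_le_eq intro!: rep_store)
  qed (use assms in simp)
  then show ?thesis by simp
qed

lemma ht_init_loop:
  assumes rep: "rep (f, 0, X, Y, L, K) R M"
  shows "ht (vertex_loop init_body) (n * 6 + 3) R M (rep (f, 0, X, Y, id, K))"
proof -
  let ?L = "\<lambda>k v. if v < k then v else L v"
  have "ht (vertex_loop init_body) (n * (2 + 4) + 3) R M (rep (f, 0, X, Y, id, K))"
  proof (rule ht_vertex_loop[where J = "\<lambda>k R M. rep (f, k, X, Y, ?L k, K) R M \<and> R 16 = n - k"])
    fix k R M assume k: "k < n" and J: "rep (f, k, X, Y, ?L k, K) R M \<and> R 16 = n - k"
    note r = rep_regs[OF conjunct1[OF J]]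
    have upd: "?L (Suc k) = (?L k)(k := k)" by (auto simp: fun_eq_iff)
    show "ht init_body 2 R M (\<lambda>R M. R 9 = k \<and> R 1 = 1 \<and> R 2 = n \<and>
        rep (f, Suc k, X, Y, ?L (Suc k), K) (R(9 := Suc k, 16 := n - Suc k)) M \<and>
        (R(9 := Suc k, 16 := n - Suc k)) 16 = n - Suc k)"
      unfolding upd using J k
      by (intro ht_run) (auto simp: init_body_def Let_def r intro!: rep_store rep_vertex)
  qed (use rep in \<open>auto simp: rep_regs intro: rep_vertex_cong\<close>)
  then show ?thesis by simp
qed

text \<open>Entry \<open>k\<close> is still the original one when the counter reaches it, so
  relabelling in place agrees with the simultaneous \<open>relabel\<close>.\<close>

lemma ht_relabel_loop:
  assumes rep: "rep (f, 0, X, Y, L, K) R M" and cd: "R 14 = c" "R 15 = d" "c < n"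
  shows "ht (vertex_loop relabel_body) (n * 12 + 3) R M
    (\<lambda>R' M'. rep (f, 0, X, Y, relabel c d L, K) R' M' \<and> keeps R R')"
proof -
  let ?L = "\<lambda>k w. if w < k \<and> L w = d then c else L w"
  let ?J = "\<lambda>k R' M. rep (f, k, X, Y, ?L k, K) R' M \<and> R' 14 = c \<and> R' 15 = d \<and> keeps R R' \<and> R' 16 = n - k"
  have "ht (vertex_loop relabel_body) (n * (8 + 4) + 3) R M
    (\<lambda>R' M'. rep (f, 0, X, Y, relabel c d L, K) R' M' \<and> keeps R R')"
  proof (rule ht_vertex_loop[where J = ?J])
    fix k R' M assume k: "k < n" and J: "?J k R' M"
    note r = rep_regs[OF conjunct1[OF J]] rep_mem[OF conjunct1[OF J] k]
    have upd: "?L (Suc k) = (if L k = d then (?L k)(k := c) else ?L k)"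
      by (auto simp: fun_eq_iff less_Suc_eq)
    show "ht relabel_body 8 R' M (\<lambda>R M. R 9 = k \<and> R 1 = 1 \<and> R 2 = n \<and> ?J (Suc k) (R(9 := Suc k, 16 := n - Suc k)) M)"
      unfolding upd using J k cd
      by (intro ht_run; cases "L k = d")
        (auto simp: relabel_body_def fetch_def test_eq_def Let_def r keeps_def le_le_eq
          intro!: rep_store rep_vertex)
  qed (use rep cd in \<open>auto simp: rep_regs keeps_def relabel_def intro: rep_vertex_cong\<close>)
  then show ?thesis by simp
qed

text \<open>Each edge triggers at most two relabellings of about \<open>12 * n\<close> steps, which
  accounts for the \<open>24\<close> in the bound.\<close>

lemma ht_merge_loop:
  assumes rep: "rep (f, 0, X, Y, id, K) R M"
  shows "ht (edge_loop merge_body) (length es * (n * 24 + 56) + 3) R M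
    (rep (f, 0, X, Y, fold (merge X Y) (arcs es) id, K))"
proof -
  let ?G = "\<lambda>d. (f, 0, X, Y, fold (merge X Y) d id, K)"
  have "ht (edge_loop merge_body) (length es * (2 * (11 + ((4 + (n * 12 + 3)) + 2)) + 10) + 3) R M (rep (?G (arcs es)))"
  proof (rule ht_edge_loop[where G = ?G])
    fix d u v r R M
    assume sp: "arcs es = d @ (u, v) # r" and rep: "rep (?G d) R M" and uv: "R 10 = u" "R 11 = v"
    have u: "u < n" and v: "v < n" using arcs_less[of u v] sp by simp_all
    let ?L = "fold (merge X Y) d id"
    let ?s = "X u + Y u + X v + Y v"
    note r = rep_regs[OF rep] rep_mem[OF rep u] rep_mem[OF rep v]
    show "ht merge_body (11 + ((4 + (n * 12 + 3)) + 2)) R M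
        (\<lambda>R' M'. rep (?G (d @ [(u, v)])) R' M' \<and> keeps R R')"
      unfolding merge_body_def
    proof (rule ht_Seq)
      show "ht (fetch 17 3 10 ;; fetch 19 6 10 ;; Ins (Add 17 17 19) ;;
          fetch 19 3 11 ;; Ins (Add 17 17 19) ;; fetch 19 6 11 ;; Ins (Add 17 17 19)) 11 R M
          (\<lambda>R' M'. rep (?G d) R' M' \<and> keeps R R' \<and> R' 17 = ?s)"
        using rep by (intro ht_run) (auto simp: fetch_def Let_def r uv keeps_def)
    next
      fix R1 M1 assume 1: "rep (?G d) R1 M1 \<and> keeps R R1 \<and> R1 17 = ?s"
      note r1 = rep_regs[OF conjunct1[OF 1]] rep_mem[OF conjunct1[OF 1] u] rep_mem[OF conjunct1[OF 1] v]
      show "ht (IfZ 17 ((fetch 14 7 10 ;; fetch 15 7 11) ;; vertex_loop relabel_body))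
          ((4 + (n * 12 + 3)) + 2) R1 M1 (\<lambda>R' M'. rep (?G (d @ [(u, v)])) R' M' \<and> keeps R R')"
      proof (rule ht_IfZ)
        assume z: "R1 17 = 0"
        show "ht ((fetch 14 7 10 ;; fetch 15 7 11) ;; vertex_loop relabel_body) (4 + (n * 12 + 3)) R1 M1
            (\<lambda>R' M'. rep (?G (d @ [(u, v)])) R' M' \<and> keeps R R')"
        proof (rule ht_Seq)
          show "ht (fetch 14 7 10 ;; fetch 15 7 11) 4 R1 M1
              (\<lambda>R' M'. rep (?G d) R' M' \<and> keeps R R' \<and> R' 14 = ?L u \<and> R' 15 = ?L v)"
            using 1 uv by (intro ht_run) (auto simp: fetch_def Let_def r1 keeps_def)
        next
          fix R2 M2 assume 2: "rep (?G d) R2 M2 \<and> keeps R R2 \<and> R2 14 = ?L u \<and> R2 15 = ?L v"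
          have upd: "?G (d @ [(u, v)]) = (f, 0, X, Y, relabel (?L u) (?L v) ?L, K)"
            using z 1 by (simp add: merge_def)
          show "ht (vertex_loop relabel_body) (n * 12 + 3) R2 M2
              (\<lambda>R' M'. rep (?G (d @ [(u, v)])) R' M' \<and> keeps R R')"
            unfolding upd
            by (rule ht_mono[OF ht_relabel_loop[of f X Y ?L K R2 M2 "?L u" "?L v"]])
              (use 2 rep_mem(5)[OF rep u] in \<open>auto simp: keeps_def\<close>)
        qed
      next
        assume nz: "R1 17 \<noteq> 0"
        have "?G (d @ [(u, v)]) = ?G d" using nz 1 by (auto simp: merge_def)
        then show "rep (?G (d @ [(u, v)])) R1 M1 \<and> keeps R R1" using 1 by simp
      qed
    qed
  qed (use rep in simp)
  then show ?thesis by (rule ht_mono) (auto simp: algebra_simps)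
qed

lemma ht_preamble:
  "ht preamble 18 (\<lambda>_. 0) (\<lambda>i. if i < length (encode n es x y) then encode n es x y ! i else 0)
    (rep (1, 0, \<lambda>v. if v = x then 1 else 0, \<lambda>v. if v = y then 1 else 0, \<lambda>_. 0, \<lambda>_. 0))"
proof -
  define M where "M = (\<lambda>i. if i < length (encode n es x y) then encode n es x y ! i else 0)"
  have M: "M 0 = n" "M (Suc 0) = length es" "M 2 = x" "M 3 = y"
    using encode_nth(1-4)[of n es x y] by (auto simp: M_def length_encode)
  have Me: "M (4 + 2 * i) = fst (es ! i)" "M (5 + 2 * i) = snd (es ! i)" if "i < length es" for i
    using encode_nth(5,6)[OF that, of n x y] that by (auto simp: M_def length_encode)
  \<comment> \<open>Memory behind the input is initially zero, so all four arrays start as zero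
    arrays.\<close>
  have M0: "M (base + k) = 0" for k
    by (simp add: M_def length_encode base_def)
  have b: "length es + length es + 4 = base" by (simp add: base_def)
  have 0: "rep (1, 0, \<lambda>_. 0, \<lambda>_. 0, \<lambda>_. 0, \<lambda>_. 0) R M"
    if "R 0 = 1" "R 1 = 1" "R 2 = n" "R 3 = base" "R 4 = x" "R 5 = y"
     "R 6 = base + n" "R 7 = base + n + n" "R 8 = base + n + n + n" "R 9 = 0" for R
    using that Me M0 x_less by (auto simp: rep_def add.assoc)
  have upd: "(\<lambda>v. if v = z then 1 else 0) = (\<lambda>_. 0)(z := 1)" for z :: nat
    by (auto simp: fun_eq_iff)
  show ?thesis
    unfolding M_def[symmetric] upd
    by (rule ht_run)
      (auto simp: preamble_def Let_def M b intro!: rep_store x_less y_less 0[unfolded One_nat_def])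
qed

section \<open>The round of a fixed vertex \<open>a\<close>\<close>

text \<open>These are the labels marked after the first two passes of round \<open>a\<close>. In the
  second disjunct \<open>w\<close> is a neighbour of \<open>a\<close> in the component of
  \<open>u\<close>, and \<open>u\<close> has a neighbour labelled \<open>c\<close>.\<close>

definition hit :: "(nat \<Rightarrow> nat) \<Rightarrow> (nat \<Rightarrow> nat) \<Rightarrow> (nat \<Rightarrow> nat) \<Rightarrow> nat \<Rightarrow> nat \<Rightarrow> bool" where
  "hit X Y L a c \<longleftrightarrow> (\<exists>v. (a, v) \<in> set (arcs es) \<and> L v = c) \<or>
     (\<exists>u v w. (u, v) \<in> set (arcs es) \<and> X u = 0 \<and> Y u = 0 \<and> (a, w) \<in> set (arcs es) \<and> L w = L u \<and> L v = c)"

definition vertex_ok :: "(nat \<Rightarrow> nat) \<Rightarrow> (nat \<Rightarrow> nat) \<Rightarrow> (nat \<Rightarrow> nat) \<Rightarrow> nat \<Rightarrow> bool" where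
  "vertex_ok X Y L a \<longleftrightarrow> (X a \<noteq> 0 \<and> Y a = 0 \<longrightarrow>
     (\<forall>v. (y, v) \<in> set (arcs es) \<and> X v = 0 \<longrightarrow> hit X Y L a (L v)))"

lemma ht_mark_nbrs_loop:
  assumes rep: "rep (f, a, X, Y, L, K) R M"
  shows "ht (edge_loop mark_nbrs_body) (length es * 30 + 3) R M
    (rep (f, a, X, Y, L, \<lambda>c. if \<exists>v. (a, v) \<in> set (arcs es) \<and> L v = c then Suc a else K c))"
proof -
  let ?K = "\<lambda>d c. if \<exists>v. (a, v) \<in> set d \<and> L v = c then Suc a else K c"
  let ?G = "\<lambda>d. (f, a, X, Y, L, ?K d)"
  have "ht (edge_loop mark_nbrs_body) (length es * (2 * 10 + 10) + 3) R M (rep (?G (arcs es)))"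
  proof (rule ht_edge_loop[where G = ?G])
    fix d u v r R M
    assume sp: "arcs es = d @ (u, v) # r" and rep: "rep (?G d) R M" and uv: "R 10 = u" "R 11 = v"
    have v: "v < n" using arcs_less[of u v] sp by simp
    have upd: "?K (d @ [(u, v)]) = (if u = a then (?K d)(L v := Suc a) else ?K d)"
      by (auto simp: fun_eq_iff)
    note r = rep_regs[OF rep] rep_mem[OF rep v]
    show "ht mark_nbrs_body 10 R M (\<lambda>R' M'. rep (?G (d @ [(u, v)])) R' M' \<and> keeps R R')"
      unfolding upd using rep v
      by (intro ht_run; cases "u = a")
        (auto simp: mark_nbrs_body_def fetch_def test_eq_def Let_def r uv keeps_def le_le_eq intro!: rep_store)
  qed (use rep in simp)
  then show ?thesis by simp
qed

text \<open>Marks set by this loop cannot trigger further ones: an arc leaving a vertex outside both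
  neighbourhoods either stays in its component, whose label is marked already, or ends in a
  vertex that is alone with its label.\<close>

lemma ht_mark_ends_loop:
  assumes rep: "rep (f, a, X, Y, L, K) R M"
    and same: "\<And>u v. (u, v) \<in> set (arcs es) \<Longrightarrow> X u = 0 \<Longrightarrow> Y u = 0 \<Longrightarrow> X v = 0 \<Longrightarrow> Y v = 0 \<Longrightarrow> L u = L v"
    and sep: "\<And>u v. X u = 0 \<Longrightarrow> Y u = 0 \<Longrightarrow> L u = L v \<Longrightarrow> X v = 0 \<and> Y v = 0"
  shows "ht (edge_loop mark_ends_body) (length es * 56 + 3) R M
    (rep (f, a, X, Y, L, \<lambda>c. if \<exists>u v. (u, v) \<in> set (arcs es) \<and> X u = 0 \<and> Y u = 0 \<and>
       K (L u) = Suc a \<and> L v = c then Suc a else K c))"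
proof -
  let ?K = "\<lambda>d c. if \<exists>u v. (u, v) \<in> set d \<and> X u = 0 \<and> Y u = 0 \<and> K (L u) = Suc a \<and> L v = c then Suc a else K c"
  let ?G = "\<lambda>d. (f, a, X, Y, L, ?K d)"
  have "ht (edge_loop mark_ends_body) (length es * (2 * 23 + 10) + 3) R M (rep (?G (arcs es)))"
  proof (rule ht_edge_loop[where G = ?G])
    fix d u v r R M
    assume sp: "arcs es = d @ (u, v) # r" and rep: "rep (?G d) R M" and uv: "R 10 = u" "R 11 = v"
    have u: "u < n" and v: "v < n" using arcs_less[of u v] sp by simp_all
    have K: "?K d (L u) = Suc a \<longleftrightarrow> K (L u) = Suc a" if "X u = 0" "Y u = 0"
    proof -
      have "L u' = L u" if "(u', v') \<in> set d" "X u' = 0" "Y u' = 0" "L v' = L u" for u' v'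
      proof -
        have "X v' = 0 \<and> Y v' = 0"
          by (rule sep[of u]) (use \<open>X u = 0\<close> \<open>Y u = 0\<close> that in auto)
        then show ?thesis using same[of u' v'] that sp by auto
      qed
      then show ?thesis by auto
    qed
    let ?b = "X u = 0 \<and> Y u = 0 \<and> K (L u) = Suc a"
    have ex: "(\<exists>u' v'. (u', v') \<in> set (d @ [(u, v)]) \<and> X u' = 0 \<and> Y u' = 0 \<and> K (L u') = Suc a \<and> L v' = c) \<longleftrightarrow>
        (\<exists>u' v'. (u', v') \<in> set d \<and> X u' = 0 \<and> Y u' = 0 \<and> K (L u') = Suc a \<and> L v' = c) \<or> ?b \<and> L v = c" for c
      by auto
    have upd: "?K (d @ [(u, v)]) = (if ?b then (?K d)(L v := Suc a) else ?K d)"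
      unfolding ex by (simp add: fun_eq_iff)
    define K' where "K' = ?K d"
    note rep' = rep[folded K'_def]
    note r = rep_regs[OF rep'] rep_mem[OF rep' u] rep_mem[OF rep' v]
    have KL: "K' (L u) = Suc a \<longleftrightarrow> K (L u) = Suc a" if "X u = 0" "Y u = 0"
      using K[OF that] by (simp only: K'_def)
    \<comment> \<open>\<open>r(16)\<close> is the bound \<open>L u < n\<close>, which makes the
      label of \<open>u\<close> a legal index into the marks.\<close>
    note rL = rep_mem(4)[OF rep' r(16)]
    have b: "?b \<longleftrightarrow> X u = 0 \<and> Y u = 0 \<and> K' (L u) = Suc a" using KL by blast
    show "ht mark_ends_body 23 R M (\<lambda>R' M'. rep (?G (d @ [(u, v)])) R' M' \<and> keeps R R')"
      unfolding upd b K'_def[symmetric] using rep' u v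
      by (intro ht_run; cases "X u = 0"; cases "Y u = 0"; cases "K' (L u) = Suc a")
        (auto simp: mark_ends_body_def fetch_def test_eq_def Let_def r rL uv keeps_def le_le_eq intro!: rep_store)
  qed (use rep in simp)
  then show ?thesis by simp
qed

lemma ht_check_loop:
  assumes rep: "rep (f, a, X, Y, L, K) R M"
  shows "ht (edge_loop check_body) (length es * 48 + 3) R M
    (rep (if \<exists>v. (y, v) \<in> set (arcs es) \<and> X v = 0 \<and> K (L v) \<noteq> Suc a then 0 else f, a, X, Y, L, K))"
proof -
  let ?f = "\<lambda>d. if \<exists>v. (y, v) \<in> set d \<and> X v = 0 \<and> K (L v) \<noteq> Suc a then 0 else f"
  let ?G = "\<lambda>d. (?f d, a, X, Y, L, K)"
  have "ht (edge_loop check_body) (length es * (2 * 19 + 10) + 3) R M (rep (?G (arcs es)))"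
  proof (rule ht_edge_loop[where G = ?G])
    fix d u v r R M
    assume sp: "arcs es = d @ (u, v) # r" and rep: "rep (?G d) R M" and uv: "R 10 = u" "R 11 = v"
    have v: "v < n" using arcs_less[of u v] sp by simp
    have upd: "?f (d @ [(u, v)]) = (if u = y \<and> X v = 0 \<and> K (L v) \<noteq> Suc a then 0 else ?f d)"
      by auto
    define f' where "f' = ?f d"
    note rep' = rep[folded f'_def]
    note r = rep_regs[OF rep'] rep_mem[OF rep' v]
    note rL = rep_mem(4)[OF rep' r(16)]
    show "ht check_body 19 R M (\<lambda>R' M'. rep (?G (d @ [(u, v)])) R' M' \<and> keeps R R')"
      unfolding upd f'_def[symmetric] using rep' v
      by (intro ht_run; cases "u = y"; cases "X v = 0"; cases "K (L v) = Suc a")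
        (auto simp: check_body_def fetch_def test_eq_def Let_def r rL uv keeps_def le_le_eq intro!: rep_flag)
  qed (use rep in simp)
  then show ?thesis by simp
qed

text \<open>Marks from earlier rounds are at most \<open>a\<close>, so the value
  \<open>Suc a\<close> identifies the fresh ones; the new bound \<open>Suc a\<close> is what the
  next round assumes.\<close>

lemma ht_vertex_body:
  assumes rep: "rep (f, a, X, Y, L, K) R M" and a: "a < n" and K: "\<And>c. K c \<le> a"
    and same: "\<And>u v. (u, v) \<in> set (arcs es) \<Longrightarrow> X u = 0 \<Longrightarrow> Y u = 0 \<Longrightarrow> X v = 0 \<Longrightarrow> Y v = 0 \<Longrightarrow> L u = L v"
    and sep: "\<And>u v. X u = 0 \<Longrightarrow> Y u = 0 \<Longrightarrow> L u = L v \<Longrightarrow> X v = 0 \<and> Y v = 0"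
  shows "ht vertex_body (length es * 134 + 16) R M
    (\<lambda>R M. \<exists>K'. rep (if vertex_ok X Y L a then f else 0, a, X, Y, L, K') R M \<and> (\<forall>c. K' c \<le> Suc a))"
    (is "ht _ _ _ _ ?Q")
proof -
  let ?m = "length es"
  note r = rep_regs[OF rep] rep_mem[OF rep a]
  \<comment> \<open>This covers the rounds skipped by the two guards, where \<open>vertex_ok\<close>
    holds vacuously.\<close>
  have triv: "?Q R' M'" if "rep (f, a, X, Y, L, K) R' M'" "vertex_ok X Y L a" for R' M'
    using that K by (intro exI[of _ K]) (auto simp: le_Suc_eq)
  define K1 where "K1 = (\<lambda>c. if \<exists>v. (a, v) \<in> set (arcs es) \<and> L v = c then Suc a else K c)"
  define K2 where "K2 = (\<lambda>c. if \<exists>u v. (u, v) \<in> set (arcs es) \<and> X u = 0 \<and> Y u = 0 \<and>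
       K1 (L u) = Suc a \<and> L v = c then Suc a else K1 c)"
  have K1: "K1 c = Suc a \<longleftrightarrow> (\<exists>v. (a, v) \<in> set (arcs es) \<and> L v = c)" for c
    using K[of c] by (auto simp: K1_def)
  have K2: "K2 c = Suc a \<longleftrightarrow> hit X Y L a c" for c
  proof -
    have "K2 c = Suc a \<longleftrightarrow> (\<exists>u v. (u, v) \<in> set (arcs es) \<and> X u = 0 \<and> Y u = 0 \<and>
       K1 (L u) = Suc a \<and> L v = c) \<or> K1 c = Suc a"
      unfolding K2_def by (simp only: split: if_split) blast
    then show ?thesis unfolding hit_def K1 by blast
  qed
  have K2_le: "K2 c \<le> Suc a" for c
    using K[of c] by (auto simp: K2_def K1_def)
  have "ht vertex_body (2 + ((2 + (((?m * 30 + 3) + ((?m * 56 + 3) + (?m * 48 + 3))) + 2)) + 1)) R M ?Q"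
    unfolding vertex_body_def
  proof (rule ht_Seq)
    show "ht (fetch 17 3 9) 2 R M (\<lambda>R M. rep (f, a, X, Y, L, K) R M \<and> R 17 = X a)"
      using rep by (intro ht_run) (auto simp: fetch_def Let_def r)
  next
    fix R M assume 1: "rep (f, a, X, Y, L, K) R M \<and> R 17 = X a"
    note r1 = rep_regs[OF conjunct1[OF 1]] rep_mem[OF conjunct1[OF 1] a]
    show "ht (IfNZ 17 (fetch 17 6 9 ;;
       IfZ 17 (edge_loop mark_nbrs_body ;; edge_loop mark_ends_body ;; edge_loop check_body)))
       ((2 + (((?m * 30 + 3) + ((?m * 56 + 3) + (?m * 48 + 3))) + 2)) + 1) R M ?Q"
    proof (rule ht_IfNZ)
      assume Xa: "R 17 \<noteq> 0"
      show "ht (fetch 17 6 9 ;;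
         IfZ 17 (edge_loop mark_nbrs_body ;; edge_loop mark_ends_body ;; edge_loop check_body))
         (2 + (((?m * 30 + 3) + ((?m * 56 + 3) + (?m * 48 + 3))) + 2)) R M ?Q"
      proof (rule ht_Seq)
        show "ht (fetch 17 6 9) 2 R M (\<lambda>R M. rep (f, a, X, Y, L, K) R M \<and> R 17 = Y a)"
          using 1 by (intro ht_run) (auto simp: fetch_def Let_def r1)
      next
        fix R' M assume 2: "rep (f, a, X, Y, L, K) R' M \<and> R' 17 = Y a"
        show "ht (IfZ 17 (edge_loop mark_nbrs_body ;; edge_loop mark_ends_body ;; edge_loop check_body))
         (((?m * 30 + 3) + ((?m * 56 + 3) + (?m * 48 + 3))) + 2) R' M ?Q"
        proof (rule ht_IfZ)
          assume Ya: "R' 17 = 0"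
          have ok: "(if \<exists>v. (y, v) \<in> set (arcs es) \<and> X v = 0 \<and> K2 (L v) \<noteq> Suc a then 0 else f) =
              (if vertex_ok X Y L a then f else 0)"
            using Xa Ya 1 2 unfolding vertex_ok_def K2 by auto
          show "ht (edge_loop mark_nbrs_body ;; edge_loop mark_ends_body ;; edge_loop check_body)
             ((?m * 30 + 3) + ((?m * 56 + 3) + (?m * 48 + 3))) R' M ?Q"
          proof (rule ht_Seq[OF ht_mark_nbrs_loop[OF conjunct1[OF 2], folded K1_def]])
            fix R M assume "rep (f, a, X, Y, L, K1) R M"
            note ends = ht_mark_ends_loop[OF this same sep, folded K2_def]
            show "ht (edge_loop mark_ends_body ;; edge_loop check_body)
               ((?m * 56 + 3) + (?m * 48 + 3)) R M ?Q"
            proof (rule ht_Seq[OF ends])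
              fix R M assume "rep (f, a, X, Y, L, K2) R M"
              from ht_check_loop[OF this, unfolded ok]
              show "ht (edge_loop check_body) (?m * 48 + 3) R M ?Q"
                by (rule ht_mono) (use K2_le in auto)
            qed
          qed
        next
          assume "R' 17 \<noteq> 0"
          then show "?Q R' M" using 2 by (intro triv) (auto simp: vertex_ok_def)
        qed
      qed
    next
      assume "R 17 = 0"
      then show "?Q R M" using 1 by (intro triv) (auto simp: vertex_ok_def)
    qed
  qed
  then show ?thesis by (rule ht_mono) auto
qed

section \<open>Main loop, complete program and running time\<close>

lemma ht_main_loop:
  assumes rep: "rep (1, 0, X, Y, L, \<lambda>_. 0) R M"
    and same: "\<And>u v. (u, v) \<in> set (arcs es) \<Longrightarrow> X u = 0 \<Longrightarrow> Y u = 0 \<Longrightarrow> X v = 0 \<Longrightarrow> Y v = 0 \<Longrightarrow> L u = L v"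
    and sep: "\<And>u v. X u = 0 \<Longrightarrow> Y u = 0 \<Longrightarrow> L u = L v \<Longrightarrow> X v = 0 \<and> Y v = 0"
  shows "ht (vertex_loop vertex_body) (n * (length es * 134 + 20) + 3) R M
    (\<lambda>R M. R 0 = (if \<forall>a<n. vertex_ok X Y L a then 1 else 0))"
proof -
  let ?f = "\<lambda>k. if \<forall>a<k. vertex_ok X Y L a then 1 else 0"
  let ?J = "\<lambda>k R M. R 16 = n - k \<and> (\<exists>K. rep (?f k, k, X, Y, L, K) R M \<and> (\<forall>c. K c \<le> k))"
  have "ht (vertex_loop vertex_body) (n * ((length es * 134 + 16) + 4) + 3) R M (\<lambda>R M. R 0 = ?f n)"
  proof (rule ht_vertex_loop[where J = ?J])
    fix k R M assume k: "k < n" and "?J k R M"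
    then obtain K where K: "rep (?f k, k, X, Y, L, K) R M" "\<And>c. K c \<le> k" by blast
    have upd: "?f (Suc k) = (if vertex_ok X Y L k then ?f k else 0)"
      by (auto simp: less_Suc_eq)
    show "ht vertex_body (length es * 134 + 16) R M (\<lambda>R M. R 9 = k \<and> R 1 = 1 \<and> R 2 = n \<and>
        ?J (Suc k) (R(9 := Suc k, 16 := n - Suc k)) M)"
    proof (rule ht_mono[OF ht_vertex_body[OF K(1) k K(2) same sep] order_refl], unfold upd)
      fix R M assume "\<exists>K'. rep (if vertex_ok X Y L k then ?f k else 0, k, X, Y, L, K') R M \<and> (\<forall>c. K' c \<le> Suc k)"
      then obtain K' where K': "rep (if vertex_ok X Y L k then ?f k else 0, k, X, Y, L, K') R M" "\<forall>c. K' c \<le> Suc k"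
        by blast
      show "R 9 = k \<and> R 1 = 1 \<and> R 2 = n \<and> (R(9 := Suc k, 16 := n - Suc k)) 16 = n - Suc k \<and>
        (\<exists>K. rep (if vertex_ok X Y L k then ?f k else 0, Suc k, X, Y, L, K) (R(9 := Suc k, 16 := n - Suc k)) M \<and>
          (\<forall>c. K c \<le> Suc k))"
        using rep_regs[OF K'(1)] rep_vertex[OF K'(1)] K'(2) by (intro conjI exI[of _ K']) simp_all
    qed
  qed (use rep in \<open>auto simp: rep_regs\<close>)
  then show ?thesis by (simp add: algebra_simps)
qed

text \<open>Joins the graph criterion with the passes: labels decide the components of
  \<open>W\<close>, and \<open>hit\<close> at the label of \<open>b\<close> expresses the criterion
  for the pair \<open>a\<close>, \<open>b\<close>.\<close>

lemma ht_avoidable_prog: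
  assumes g: "ugraph {..<n} E" and arcs_E: "\<And>u v. (u, v) \<in> set (arcs es) \<longleftrightarrow> {u, v} \<in> E"
    and xy: "{x, y} \<in> E"
  shows "ht avoidable_prog (158 * (n * length es) + 94 * length es + 26 * n + 30) (\<lambda>_. 0)
    (\<lambda>i. if i < length (encode n es x y) then encode n es x y ! i else 0)
    (\<lambda>R M. R 0 = (if avoidable_edge {..<n} E {x, y} then 1 else 0))"
proof -
  let ?m = "length es"
  define W where "W = - (closed_nbhd E x \<union> closed_nbhd E y)"
  define X :: "nat \<Rightarrow> nat" where "X = (\<lambda>v. if v = x \<or> (x, v) \<in> set (arcs es) then 1 else 0)"
  define Y :: "nat \<Rightarrow> nat" where "Y = (\<lambda>v. if v = y \<or> (y, v) \<in> set (arcs es) then 1 else 0)"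
  define L where "L = fold (merge X Y) (arcs es) id"
  have X: "X v = 0 \<longleftrightarrow> v \<notin> closed_nbhd E x" and Y: "Y v = 0 \<longleftrightarrow> v \<notin> closed_nbhd E y" for v
    by (auto simp: X_def Y_def closed_nbhd_def arcs_E)
  have W: "v \<in> W \<longleftrightarrow> X v = 0 \<and> Y v = 0" for v
    by (auto simp: W_def X Y)
  have S: "{(u, v) \<in> set (arcs es). X u = 0 \<and> Y u = 0 \<and> X v = 0 \<and> Y v = 0} = edge_rel E W"
    by (auto simp: edge_rel_def W arcs_E)
  have sym: "sym (edge_rel E W)" by (auto simp: sym_def edge_rel_def insert_commute)
  have L: "L u = L v \<longleftrightarrow> (u, v) \<in> (edge_rel E W)\<^sup>*" for u v
    unfolding L_def using fold_merge_eq_iff[of "arcs es" X Y u v] sym unfolding S by simp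
  have LW: "u \<in> W \<longleftrightarrow> v \<in> W" if "L u = L v" "u \<noteq> v" for u v
  proof -
    have "(u, v) \<in> (edge_rel E W)\<^sup>+" using that by (simp add: L rtrancl_eq_or_trancl)
    then have "u \<in> W \<and> v \<in> W" by (induction rule: trancl_induct) (auto simp: edge_rel_def)
    then show ?thesis by simp
  qed
  \<comment> \<open>Distinct vertices share a label only along a nontrivial walk, and every vertex
    of such a walk lies in \<open>W\<close>.\<close>
  have LW': "u = v" if "L u = L v" "u \<notin> W" for u v
  proof (rule ccontr)
    assume "u \<noteq> v"
    then have "(u, v) \<in> (edge_rel E W)\<^sup>+" using that by (simp add: L rtrancl_eq_or_trancl)
    then have "u \<in> W" by (induction rule: trancl_induct) (auto simp: edge_rel_def)
    then show False using that by simp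
  qed
  have same: "L u = L v" if "(u, v) \<in> set (arcs es)" "X u = 0" "Y u = 0" "X v = 0" "Y v = 0" for u v
    unfolding L S[symmetric] using that by auto
  have sep: "X v = 0 \<and> Y v = 0" if "X u = 0" "Y u = 0" "L u = L v" for u v
    using LW[of u v] that W by (cases "u = v") auto
  \<comment> \<open>For \<open>b\<close> outside \<open>W\<close> the label singles out
    \<open>b\<close>: the first disjunct of \<open>hit\<close> becomes adjacency, the second a
    common component of neighbours of \<open>a\<close> and \<open>b\<close>.\<close>
  have hit: "hit X Y L a (L b) \<longleftrightarrow> {a, b} \<in> E \<or>
      (\<exists>w w'. w \<in> W \<and> w' \<in> W \<and> {a, w} \<in> E \<and> {w', b} \<in> E \<and> (w, w') \<in> (edge_rel E W)\<^sup>*)"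
    if "b \<notin> W" for a b
  proof -
    have eq: "L v = L b \<longleftrightarrow> v = b" for v using LW'[of b v] that by auto
    have inW: "w \<in> W" if "u \<in> W" "L w = L u" for u w
      using LW[OF that(2)] that(1) by (cases "w = u") simp_all
    have "(\<exists>u v w. {u, v} \<in> E \<and> X u = 0 \<and> Y u = 0 \<and> {a, w} \<in> E \<and> L w = L u \<and> v = b) \<longleftrightarrow>
        (\<exists>w w'. w \<in> W \<and> w' \<in> W \<and> {a, w} \<in> E \<and> {w', b} \<in> E \<and> L w = L w')"
      (is "?l \<longleftrightarrow> ?r")
    proof
      assume ?l
      then obtain u w where "{u, b} \<in> E" "u \<in> W" "{a, w} \<in> E" "L w = L u" unfolding W by metis
      then show ?r using inW[of u w] by metis
    next
      assume ?r
      then obtain w w' where "w' \<in> W" "{a, w} \<in> E" "{w', b} \<in> E" "L w = L w'" by metis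
      then show ?l unfolding W by metis
    qed
    then show ?thesis unfolding hit_def eq arcs_E L[symmetric] by simp
  qed
  \<comment> \<open>The program inspects only \<open>a < n\<close>, whereas the criterion ranges
    over all naturals.\<close>
  have less: "a < n" if "a \<in> closed_nbhd E x" for a
  proof -
    have "e \<in> E \<Longrightarrow> e \<subseteq> {..<n}" for e using g unfolding ugraph_def by blast
    from this[of "{x, a}"] show ?thesis using that x_less by (auto simp: closed_nbhd_def)
  qed
  have avoidable: "(\<forall>a<n. vertex_ok X Y L a) \<longleftrightarrow> avoidable_edge {..<n} E {x, y}"
  proof -
    have "(\<forall>a<n. vertex_ok X Y L a) \<longleftrightarrow> (\<forall>a b. a \<in> closed_nbhd E x - closed_nbhd E y \<longrightarrow>
        b \<in> closed_nbhd E y - closed_nbhd E x \<longrightarrow> hit X Y L a (L b))"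
    proof -
      have b: "{y, b} \<in> E \<and> X b = 0 \<longleftrightarrow> b \<in> closed_nbhd E y - closed_nbhd E x" for b
        using xy by (auto simp: X closed_nbhd_def)
      have a: "X a \<noteq> 0 \<and> Y a = 0 \<longleftrightarrow> a \<in> closed_nbhd E x - closed_nbhd E y" for a
        by (simp add: X Y)
      show ?thesis unfolding vertex_ok_def arcs_E a b using less by blast
    qed
    also have "\<dots> \<longleftrightarrow> avoidable_edge {..<n} E {x, y}"
    proof -
      have "b \<notin> W" if "b \<in> closed_nbhd E y - closed_nbhd E x" for b
        using that by (simp add: W_def)
      note eq = imp_cong[OF refl hit[OF this]]
      show ?thesis
        unfolding avoidable_edge_iff[OF g xy] W_def[symmetric] by (simp only: eq)
    qed
    finally show ?thesis .
  qed
  have "ht avoidable_prog (18 + ((?m * 38 + 3) + ((n * 6 + 3) + ((?m * (n * 24 + 56) + 3) +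
      (n * (?m * 134 + 20) + 3))))) (\<lambda>_. 0)
    (\<lambda>i. if i < length (encode n es x y) then encode n es x y ! i else 0)
    (\<lambda>R M. R 0 = (if \<forall>a<n. vertex_ok X Y L a then 1 else 0))"
    unfolding avoidable_prog_def
  proof (rule ht_Seq[OF ht_preamble], rule ht_Seq[OF ht_nbhd_loop], assumption,
      rule ht_Seq[OF ht_init_loop], assumption, rule ht_Seq[OF ht_merge_loop], assumption)
    fix R M
    assume "rep (1, 0, \<lambda>v. if v = x \<or> (x, v) \<in> set (arcs es) then 1 else 0,
      \<lambda>v. if v = y \<or> (y, v) \<in> set (arcs es) then 1 else 0,
      fold (merge (\<lambda>v. if v = x \<or> (x, v) \<in> set (arcs es) then 1 else 0)
        (\<lambda>v. if v = y \<or> (y, v) \<in> set (arcs es) then 1 else 0)) (arcs es) id, \<lambda>_. 0) R M"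
    then have "rep (1, 0, X, Y, L, \<lambda>_. 0) R M" unfolding L_def X_def Y_def .
    then show "ht (vertex_loop vertex_body) (n * (?m * 134 + 20) + 3) R M
        (\<lambda>R M. R 0 = (if \<forall>a<n. vertex_ok X Y L a then 1 else 0))"
      by (rule ht_main_loop) (fact same sep)+
  qed
  then show ?thesis unfolding avoidable
    by (rule ht_mono) (auto simp: algebra_simps)
qed

end

theorem theorem30:
  "\<exists>(P :: program) (C :: nat). \<forall>(n :: nat) (m :: nat) (E :: nat set set) (es :: (nat \<times> nat) list)
      (x :: nat) (y :: nat).
     ugraph {..<n} E \<and> card E = m \<and> lists_edges es E \<and> {x, y} \<in> E \<longrightarrow>
     answers_within P (encode n es x y) (avoidable_edge {..<n} E {x, y}) (C * (n * m))"
proof (rule exI[of _ "compile 0 avoidable_prog"], rule exI[of _ 308], intro allI impI, elim conjE)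
  fix n m E es x y
  assume g: "ugraph {..<n} E" and m: "card E = m" and es: "lists_edges es E" and xy: "{x, y} \<in> E"
  have len: "length es = m"
    using es m distinct_card[of "map (\<lambda>(u, v). {u, v}) es"] by (simp add: lists_edges_def)
  have E: "{u, v} \<in> E \<Longrightarrow> u < n \<and> v < n \<and> u \<noteq> v" for u v
  proof -
    assume "{u, v} \<in> E"
    then have "{u, v} \<subseteq> {..<n}" "card {u, v} = 2" using g unfolding ugraph_def by blast+
    then show ?thesis by (cases "u = v") auto
  qed
  have es_E: "(\<lambda>(u, v). {u, v}) ` set es = E" using es by (simp add: lists_edges_def)
  have arcs_E: "(u, v) \<in> set (arcs es) \<longleftrightarrow> {u, v} \<in> E" for u v
    unfolding es_E[symmetric] set_arcs by (auto simp: doubleton_eq_iff image_iff split: prod.splits)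
  interpret edge_instance n es x y
  proof
    fix u v assume "(u, v) \<in> set es"
    then have "{u, v} \<in> E" using arcs_E[of u v] by (simp add: set_arcs)
    then show "u < n \<and> v < n" using E[of u v] by simp
  qed (use E[OF xy] in simp_all)
  have pos: "1 \<le> n" "1 \<le> length es"
    using x_less xy es_E by (auto simp: Suc_le_eq)
  \<comment> \<open>The constant is the sum 158 + 94 + 26 + 30. As there is an edge, both factors
    are at least 1, so each term is bounded by its coefficient times the product.\<close>
  have "158 * (n * length es) + 94 * length es + 26 * n + 30 \<le> 308 * (n * length es)"
  proof -
    have "length es \<le> n * length es" "n \<le> n * length es" "1 \<le> n * length es"
      using pos by auto
    then show ?thesis by linarith
  qed
  then show "answers_within (compile 0 avoidable_prog) (encode n es x y) (avoidable_edge {..<n} E {x, y}) (308 * (n * m))"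
    unfolding len[symmetric]
    by (intro ht_answers_within ht_mono[OF ht_avoidable_prog[OF g arcs_E xy]])
qed

end
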